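(* For $g\ge 0$ and $\alpha$ a partition of $n\ge 1$ with $m$ parts, $$a_g(\alpha)=\frac{1}{n!}\sum_{h=0}^{g}\frac{b_{g-h}(\alpha)}{n^{m-2+2g-2h}}\binom{n+m-2+2g}{n-1+2h}\sum_{j=0}^{n-1}\binom{n-1}{j}(-1)^j\left(\tfrac12(n-1)-j\right)^{n-1+2h}.$$
   Context: $\mathfrak{S}_n$ is the symmetric group on $[n]=\{1,\ldots,n\}$. $\mathcal{K}_\alpha$ is the conjugacy class of permutations in $\mathfrak{S}_n$ with cycle type the partition $\alpha$ of $n$. The convention $0^0=1$ is used. Star factorization number $a_g(\alpha)$: for a partition $\alpha$ of $n$ with $m$ parts and $g\ge0$, $a_g(\alpha)$ is the number, for each fixed $\sigma\in\mathcal{K}_\alpha$, of tuples $(\tau_1,\ldots,\tau_r)$ with $r=n+m-2+2g$, where each $\tau_j$ is a transposition of the form $(i\,n)$ with $i\in[n-1]$ (a star transposition with pivot $n$), such that $\tau_1\cdots\tau_r=\sigma$ and the group generated by $\tau_1,\ldots,\tau_r$ acts transitively on $[n]$. (This number is the same for every $\sigma\in\mathcal{K}_\alpha$. Equivalently, $a_g(\alpha)$ is the coefficient of $\mathsf{K}_\alpha=\sum_{\pi\in\mathcal{K}_\alpha}\pi$ in the sum, in $\mathbb{C}\mathfrak{S}_n$, of all products $(i_1\,n)\cdots(i_r\,n)$ whose factors generate a transitive group on $[n]$.) The number $b_g(\alpha)$: for a partition $\alpha$ of $n$ with $m$ parts and $g\ge0$, $b_g(\alpha)$ is the number, for each fixed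 $\sigma\in\mathcal{K}_\alpha$, of factorizations of $\sigma$ as an ordered product $\tau_1\cdots\tau_{s}\,c$ with $s=m-1+2g$, where $\tau_1,\ldots,\tau_s$ are arbitrary transpositions in $\mathfrak{S}_n$ and $c$ is an $n$-cycle. Equivalently, it is the coefficient of $\mathsf{K}_\alpha$ in $\mathsf{K}_{(1^{n-2}\,2)}^{\,s}\,\mathsf{K}_{(n)}$ in $\mathbb{C}\mathfrak{S}_n$. (In terms of double Hurwitz numbers, $b_g(\alpha)=\alpha_1\cdots\alpha_m H^g_{(n),\alpha}$.) *)

theory Defs
  imports
    Complex_Main
    "HOL-Library.Multiset"
    "HOL-Combinatorics.Orbits"
    "HOL-Algebra.Sym_Groups"
begin

definition partition_of :: "nat multiset \<Rightarrow> nat \<Rightarrow> bool"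
  where "partition_of \<alpha> n \<longleftrightarrow> 0 \<notin># \<alpha> \<and> \<Sum>\<^sub># \<alpha> = n"

text \<open>For a permutation the sets \<open>Orbits.orbit \<sigma> x\<close> are the supports of the cycles of \<open>\<sigma>\<close>,
  fixed points included; the image is a set, so each cycle contributes its length once.\<close>

definition cycle_type :: "nat \<Rightarrow> (nat \<Rightarrow> nat) \<Rightarrow> nat multiset"
  where "cycle_type n \<sigma> = image_mset card (mset_set (Orbits.orbit \<sigma> ` {1..n}))"

definition conj_class :: "nat multiset \<Rightarrow> (nat \<Rightarrow> nat) set"
  where "conj_class \<alpha> =
    {\<sigma> \<in> carrier (sym_group (\<Sum>\<^sub># \<alpha>)). cycle_type (\<Sum>\<^sub># \<alpha>) \<sigma> = \<alpha>}"

definition transpositions :: "nat \<Rightarrow> (nat \<Rightarrow> nat) set"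
  where "transpositions n = {transpose i j | i j. i \<in> {1..n} \<and> j \<in> {1..n} \<and> i \<noteq> j}"

definition star_transpositions :: "nat \<Rightarrow> (nat \<Rightarrow> nat) set"
  where "star_transpositions n = {transpose i n | i. i \<in> {1..n-1}}"

text \<open>Products of permutations are compositions, as in \<^const>\<open>sym_group\<close>; the opposite
  convention gives the same counts.\<close>

definition perm_product :: "(nat \<Rightarrow> nat) list \<Rightarrow> nat \<Rightarrow> nat"
  where "perm_product \<tau>s = foldr (\<circ>) \<tau>s id"

definition generates_transitive :: "nat \<Rightarrow> (nat \<Rightarrow> nat) set \<Rightarrow> bool"
  where "generates_transitive n T \<longleftrightarrow>
    (\<forall>x\<in>{1..n}. \<forall>y\<in>{1..n}. \<exists>p\<in>generate (sym_group n) T. p x = y)"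

definition star_factorizations :: "nat \<Rightarrow> nat \<Rightarrow> (nat \<Rightarrow> nat) \<Rightarrow> (nat \<Rightarrow> nat) list set"
  where "star_factorizations n r \<sigma> =
    {\<tau>s. length \<tau>s = r \<and> set \<tau>s \<subseteq> star_transpositions n \<and>
         perm_product \<tau>s = \<sigma> \<and> generates_transitive n (set \<tau>s)}"

definition cycle_factorizations ::
    "nat \<Rightarrow> nat \<Rightarrow> (nat \<Rightarrow> nat) \<Rightarrow> ((nat \<Rightarrow> nat) list \<times> (nat \<Rightarrow> nat)) set"
  where "cycle_factorizations n s \<sigma> =
    {(\<tau>s, c). length \<tau>s = s \<and> set \<tau>s \<subseteq> transpositions n \<and> c \<in> conj_class {#n#} \<and>
              perm_product \<tau>s \<circ> c = \<sigma>}"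

text \<open>The numbers \<open>a\<^sub>g(\<alpha>)\<close> and \<open>b\<^sub>g(\<alpha>)\<close>: the common value of the count
  over all \<open>\<sigma>\<close> of cycle type \<open>\<alpha>\<close>. For a partition of a positive integer the truncated
  subtractions in the lengths are exact.\<close>

definition star_number :: "nat \<Rightarrow> nat multiset \<Rightarrow> nat"
  where "star_number g \<alpha> =
    (THE k. \<forall>\<sigma>\<in>conj_class \<alpha>.
       card (star_factorizations (\<Sum>\<^sub># \<alpha>) (\<Sum>\<^sub># \<alpha> + size \<alpha> - 2 + 2 * g) \<sigma>) = k)"

definition cycle_number :: "nat \<Rightarrow> nat multiset \<Rightarrow> nat"
  where "cycle_number g \<alpha> =
    (THE k. \<forall>\<sigma>\<in>conj_class \<alpha>.
       card (cycle_factorizations (\<Sum>\<^sub># \<alpha>) (size \<alpha> - 1 + 2 * g) \<sigma>) = k)"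

end

theory Submission
  imports Defs "HOL-Computational_Algebra.Formal_Power_Series"
begin

text \<open>Write \<open>S\<^sub>a = e\<^bsup>ax/2\<^esup> - e\<^bsup>-ax/2\<^esup>\<close> and, for a permutation \<open>\<sigma>\<close> with cycle lengths \<open>\<alpha>\<^sub>1, \<dots>, \<alpha>\<^sub>m\<close>, put
  \<open>Q(\<sigma>) = S\<^bsub>\<alpha>\<^sub>1\<^esub> \<cdots> S\<^bsub>\<alpha>\<^sub>m\<^esub> / S\<^sub>1\<close>. Multiplying \<open>\<sigma>\<close> by a transposition cuts a cycle in two or joins two cycles, and
  the addition theorem for \<open>S\<close> evaluates the sum of \<open>Q((j p)\<sigma>)\<close> over all \<open>j\<close> for a fixed pivot \<open>p\<close>. Summing this
  over \<open>p\<close> as well gives \<open>n Q' = \<Sum> Q(\<tau>\<sigma>)\<close> over all transpositions \<open>\<tau>\<close>, so \<open>Q(\<sigma>)(nx)/n\<close> satisfies the recursion of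
  the exponential generating function of the numbers of factorizations \<open>\<tau>\<^sub>1 \<cdots> \<tau>\<^sub>s c\<close> and equals it.
  Removing the first factor \<open>(i n)\<close> of a transitive star factorization either keeps the support or drops \<open>i\<close>;
  the pivot sum shows that \<open>S\<^sub>1\<^bsup>n-1\<^esup> Q(\<sigma>) / n!\<close> satisfies this recursion. So the two generating functions differ
  by a rescaling and a power of \<open>S\<^sub>1\<close>, whose coefficients are the alternating sums of the formula.\<close>

unbundle fps_syntax

section \<open>Cutting and joining cycles with a transposition\<close>

text \<open>Used with \<open>g = transpose j p \<circ> f\<close>: the two maps differ only at steps
  whose \<open>f\<close>-image is a swapped point, so a stretch of a walk without such steps is
  unchanged.\<close>

lemma funpow_cong_prefix:
  assumes "\<And>i. i < k \<Longrightarrow> g ((f ^^ i) x) = f ((f ^^ i) x)"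
  shows "(g ^^ k) x = (f ^^ k) x"
  using assms by (induction k) auto

text \<open>The least positive return time \<open>funpow_dist1 f x x\<close> is the length of the
  cycle, so its points are indexed by exponents; cutting and joining then become arithmetic on
  exponents.\<close>

lemma orbit_enumeration:
  assumes "permutation f"
  shows "(f ^^ card (orbit f x)) x = x"
    and "inj_on (\<lambda>k. (f ^^ k) x) {0..<card (orbit f x)}"
    and "orbit f x = (\<lambda>k. (f ^^ k) x) ` {0..<card (orbit f x)}"
    and "0 < card (orbit f x)"
proof -
  have x: "x \<in> orbit f x"
    by (rule permutation_self_in_orbit[OF assms])
  have c: "card (orbit f x) = funpow_dist1 f x x"
    by (subst orbit_conv_funpow_dist1[OF x], subst card_image[OF inj_on_funpow_dist1[OF x]]) simp
  show "(f ^^ card (orbit f x)) x = x"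
    unfolding c by (rule funpow_dist1_prop[OF x])
  show "inj_on (\<lambda>k. (f ^^ k) x) {0..<card (orbit f x)}"
    unfolding c by (rule inj_on_funpow_dist1[OF x])
  show "orbit f x = (\<lambda>k. (f ^^ k) x) ` {0..<card (orbit f x)}"
    unfolding c by (rule orbit_conv_funpow_dist1[OF x])
  show "0 < card (orbit f x)"
    unfolding c by simp
qed

lemma orbit_disjoint_or_equal:
  assumes "permutation f" "orbit f x \<inter> orbit f y \<noteq> {}"
  shows "orbit f x = orbit f y"
proof -
  obtain z where "z \<in> orbit f x" "z \<in> orbit f y" using assms(2) by auto
  then show ?thesis
    using orbit_cyclic_eq3[OF cyclic_on_orbit'[OF assms(1)]] by metis
qed

lemma funpow_orbit_closed:
  assumes "(f ^^ k) x = x" "0 < k"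
  shows "orbit f x = (\<lambda>i. (f ^^ i) x) ` {0..<k}"
  using orbit_altdef_bounded[OF assms] by auto

lemma permutation_transpose_comp:
  assumes "f permutes V" "finite V" "j \<in> V" "p \<in> V"
  shows "(transpose j p \<circ> f) permutes V" "permutation (transpose j p \<circ> f)"
proof -
  show 1: "(transpose j p \<circ> f) permutes V"
    using assms by (intro permutes_compose permutes_swap_id)
  show "permutation (transpose j p \<circ> f)"
    using 1 assms(2) by (auto simp: permutation_permutes)
qed

lemma orbit_transpose_comp_other:
  assumes "permutation f" "x \<notin> orbit f p" "x \<notin> orbit f j"
  shows "orbit (transpose j p \<circ> f) x = orbit f x"
proof (rule orbit_cong[OF permutation_self_in_orbit[OF assms(1)]])
  fix s assume s: "s \<in> orbit f x"
  then have "f s \<in> orbit f x" by (rule orbit.step)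
  then have "f s \<noteq> p" "f s \<noteq> j"
    using assms by (metis orbit_swap permutation_self_in_orbit)+
  then show "(transpose j p \<circ> f) s = f s" by simp
qed

text \<open>Along the cycle p, f p, f^2 p, ... the step into j = f^b p is redirected to p, which
  closes up the first b points. The step back into p is redirected to j, which closes up the
  remaining ones. All other cycles avoid both points.\<close>

lemma orbits_transpose_cut:
  fixes f :: "'a \<Rightarrow> 'a"
  assumes f: "f permutes V" "finite V" and p: "p \<in> V"
    and b: "0 < b" "b < card (orbit f p)"
  defines "g \<equiv> transpose ((f ^^ b) p) p \<circ> f"
  obtains A B where "orbit g ` V = insert A (insert B (orbit f ` V - {orbit f p}))"
    "A \<noteq> B" "A \<notin> orbit f ` V - {orbit f p}" "B \<notin> orbit f ` V - {orbit f p}"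
    "card A = b" "card B = card (orbit f p) - b"
proof -
  have pf: "permutation f" using f by (auto simp: permutation_permutes)
  define c where "c = card (orbit f p)"
  define j where "j = (f ^^ b) p"
  note en = orbit_enumeration[OF pf, of p, folded c_def]
  have bc: "0 < b" "b < c" using b by (auto simp: c_def)
  have inj: "i = k" if "i < c" "k < c" "(f ^^ i) p = (f ^^ k) p" for i k
    using en(2) that by (auto simp: inj_on_def)
  have jP: "j \<in> orbit f p" using en(3) bc by (auto simp: j_def)
  have jV: "j \<in> V" using jP permutes_orbit_subset[OF f(1) p] by auto
  have g: "g = transpose j p \<circ> f" by (simp add: g_def j_def)
  have pg: "permutation g"
    unfolding g using permutation_transpose_comp[OF f jV p] by auto
  \<comment> \<open>Before exponent b the walk from p meets neither j nor p again, so the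
    transposition does nothing.\<close>
  have gp: "(g ^^ k) p = (f ^^ k) p" if "k < b" for k
  proof (rule funpow_cong_prefix)
    fix i assume "i < k"
    then have "Suc i < b" using that by simp
    then have "(f ^^ Suc i) p \<noteq> (f ^^ b) p" "(f ^^ Suc i) p \<noteq> (f ^^ 0) p"
      using inj[of "Suc i" b] inj[of "Suc i" 0] bc by auto
    then show "g ((f ^^ i) p) = f ((f ^^ i) p)" by (simp add: g j_def)
  qed
  have gpb: "(g ^^ b) p = p"
  proof -
    obtain b' where b': "b = Suc b'" using bc by (cases b) auto
    have "(g ^^ b) p = g ((f ^^ b') p)" using gp[of b'] b' by simp
    also have "\<dots> = transpose j p j" by (simp add: g j_def b')
    finally show ?thesis by simp
  qed
  have gj: "(g ^^ k) j = (f ^^ (b + k)) p" if "k < c - b" for k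
  proof -
    have "(g ^^ k) j = (f ^^ k) j"
    proof (rule funpow_cong_prefix)
      fix i assume "i < k"
      then have *: "Suc (b + i) < c" using that by simp
      have e: "f ((f ^^ i) j) = (f ^^ (Suc (b + i))) p"
        by (simp add: j_def funpow_add add.commute[of b])
      have "(f ^^ (Suc (b + i))) p \<noteq> (f ^^ b) p" "(f ^^ (Suc (b + i))) p \<noteq> (f ^^ 0) p"
        using inj[of "Suc (b + i)" b] inj[of "Suc (b + i)" 0] bc * by auto
      then show "g ((f ^^ i) j) = f ((f ^^ i) j)" using e by (simp add: g j_def)
    qed
    then show ?thesis by (simp add: j_def funpow_add add.commute[of b])
  qed
  \<comment> \<open>The last step of the old cycle would return to p; the transposition sends it to
    j instead.\<close>
  have gjc: "(g ^^ (c - b)) j = j"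
  proof -
    obtain b' where b': "c - b = Suc b'" using bc by (cases "c - b") auto
    have "(g ^^ (c - b)) j = g ((f ^^ (b + b')) p)" using gj[of b'] b' by simp
    also have "\<dots> = transpose j p ((f ^^ Suc (b + b')) p)" by (simp add: g)
    also have "Suc (b + b') = c" using b' by simp
    finally show ?thesis using en(1) by simp
  qed
  define A where "A = orbit g p"
  define B where "B = orbit g j"
  have A: "A = (\<lambda>i. (f ^^ i) p) ` {0..<b}"
    unfolding A_def using funpow_orbit_closed[OF gpb bc(1)] gp by auto
  have B: "B = (\<lambda>i. (f ^^ i) p) ` {b..<c}"
  proof -
    have "B = (\<lambda>i. (g ^^ i) j) ` {0..<c - b}"
      unfolding B_def using funpow_orbit_closed[OF gjc] bc by auto
    also have "\<dots> = (\<lambda>i. (f ^^ (b + i)) p) ` {0..<c - b}" using gj by auto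
    also have "\<dots> = (\<lambda>i. (f ^^ i) p) ` ((+) b ` {0..<c - b})" by (simp only: image_image)
    also have "(+) b ` {0..<c - b} = {b..<c}" using bc by simp
    finally show ?thesis .
  qed
  have AB: "A \<union> B = orbit f p"
    unfolding A B en(3) image_Un[symmetric] using bc by (simp add: ivl_disj_un)
  have disj: "A \<inter> B = {}"
  proof -
    have "False" if "i < b" "b \<le> k" "k < c" "(f ^^ i) p = (f ^^ k) p" for i k
      using inj[of i k] that by simp
    then show ?thesis unfolding A B by (auto simp: image_iff)
  qed
  have ne: "A \<noteq> {}" "B \<noteq> {}" using A B bc by auto
  have cA: "card A = b"
    unfolding A using bc inj by (subst card_image) (auto simp: inj_on_def)
  have cB: "card B = c - b"
    unfolding B using bc inj by (subst card_image) (auto simp: inj_on_def)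
  \<comment> \<open>Distinct orbits are disjoint, so A and B do not occur among the untouched
    orbits; products over orbits can therefore split them off as new factors.\<close>
  have fresh: "X \<notin> orbit f ` V - {orbit f p}" if "X \<subseteq> orbit f p" "X \<noteq> {}" for X
    using that orbit_disjoint_or_equal[OF pf] by blast
  have oth: "orbit g x = orbit f x" if "x \<notin> orbit f p" for x
    unfolding g using that orbit_transpose_comp_other[OF pf, of x p j] jP
    by (metis orbit_cyclic_eq3 cyclic_on_orbit' pf)
  have inP: "orbit g x = A \<or> orbit g x = B" if "x \<in> orbit f p" for x
    using that AB unfolding A_def B_def
    by (metis Un_iff orbit_cyclic_eq3 cyclic_on_orbit' pg)
  have other: "x \<notin> orbit f p" if "orbit f x \<noteq> orbit f p" for x
    using that by (metis orbit_cyclic_eq3 cyclic_on_orbit' pf)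
  have "orbit g ` V = insert A (insert B (orbit f ` V - {orbit f p}))"
  proof (intro equalityI subsetI)
    fix X assume "X \<in> orbit g ` V"
    then obtain x where x: "x \<in> V" "X = orbit g x" by auto
    show "X \<in> insert A (insert B (orbit f ` V - {orbit f p}))"
    proof (cases "x \<in> orbit f p")
      case True
      then show ?thesis using inP x by auto
    next
      case False
      then have "orbit f x \<noteq> orbit f p" using permutation_self_in_orbit[OF pf, of x] by auto
      then show ?thesis using oth[OF False] x by auto
    qed
  next
    fix X assume "X \<in> insert A (insert B (orbit f ` V - {orbit f p}))"
    then consider "X = A" | "X = B" | x where "x \<in> V" "X = orbit f x" "orbit f x \<noteq> orbit f p" by auto
    then show "X \<in> orbit g ` V"
    proof cases
      case 3
      then show ?thesis using oth[OF other] by (metis imageI)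
    qed (use p jV in \<open>auto simp: A_def B_def\<close>)
  qed
  moreover have "A \<noteq> B" using disj ne by auto
  moreover have "A \<notin> orbit f ` V - {orbit f p}" "B \<notin> orbit f ` V - {orbit f p}"
    using fresh[of A] fresh[of B] AB ne by auto
  ultimately show ?thesis
    using cA cB by (intro that[of A B]) (simp_all add: c_def)
qed

text \<open>The step closing the cycle of p now leads into j, and the step closing the cycle of j
  leads into p, so the two cycles are traversed in one round.\<close>

lemma orbits_transpose_join:
  fixes f :: "'a \<Rightarrow> 'a"
  assumes f: "f permutes V" "finite V" and p: "p \<in> V" and j: "j \<in> V" "j \<notin> orbit f p"
  defines "g \<equiv> transpose j p \<circ> f" and "U \<equiv> orbit f p \<union> orbit f j"
  shows "orbit g ` V = insert U (orbit f ` V - {orbit f p, orbit f j})"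
    and "U \<notin> orbit f ` V - {orbit f p, orbit f j}"
    and "card U = card (orbit f p) + card (orbit f j)"
proof -
  have pf: "permutation f" using f by (auto simp: permutation_permutes)
  have pg: "permutation g"
    unfolding g_def using permutation_transpose_comp[OF f j(1) p] by auto
  have neq: "orbit f p \<noteq> orbit f j"
    using j permutation_self_in_orbit[OF pf] by metis
  then have disj: "orbit f p \<inter> orbit f j = {}"
    using orbit_disjoint_or_equal[OF pf] by blast
  have fin: "finite (orbit f x)" for x
    using finite_orbit permutation_self_in_orbit[OF pf] by metis
  show "card U = card (orbit f p) + card (orbit f j)"
    unfolding U_def using disj fin by (simp add: card_Un_disjoint)
  show "U \<notin> orbit f ` V - {orbit f p, orbit f j}"
  proof
    assume "U \<in> orbit f ` V - {orbit f p, orbit f j}"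
    then obtain x where x: "U = orbit f x" "orbit f x \<noteq> orbit f p" by auto
    moreover have "orbit f x \<inter> orbit f p \<noteq> {}"
      using x orbit_nonempty[of f p] unfolding U_def by auto
    ultimately show False using orbit_disjoint_or_equal[OF pf] by blast
  qed
  \<comment> \<open>From y the map g follows f around the whole cycle and is redirected only at the
    closing step. Stated for generic y and z because it is applied with the roles of p and j in both
    orders.\<close>
  have walk: "orbit f y \<subseteq> orbit g y" if y: "g \<equiv> transpose z y \<circ> f" "z \<notin> orbit f y" for y z
  proof -
    define c where "c = card (orbit f y)"
    note en = orbit_enumeration[OF pf, of y, folded c_def]
    have "(f ^^ k) y \<in> orbit g y" if "k < c" for k
    proof -
      have "(g ^^ k) y = (f ^^ k) y"
      proof (rule funpow_cong_prefix)
        fix i assume "i < k"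
        then have *: "Suc i < c" using that by simp
        have "(f ^^ Suc i) y \<noteq> (f ^^ 0) y"
          using en(2) * unfolding inj_on_def by fastforce
        moreover have "(f ^^ Suc i) y \<in> orbit f y"
          by (rule funpow_in_orbit[OF permutation_self_in_orbit[OF pf]])
        then have "(f ^^ Suc i) y \<noteq> z" using y(2) by auto
        ultimately show "g ((f ^^ i) y) = f ((f ^^ i) y)" by (simp add: y)
      qed
      then show ?thesis
        by (metis funpow_in_orbit permutation_self_in_orbit[OF pg])
    qed
    then show ?thesis using en(3) by auto
  qed
  have "p \<notin> orbit f j" using disj permutation_self_in_orbit[OF pf, of p] by auto
  then have sub: "orbit f p \<subseteq> orbit g p" "orbit f j \<subseteq> orbit g j"
    using walk[of j p] walk[of p j] j by (auto simp: g_def transpose_commute)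
  \<comment> \<open>The last point of the cycle of p, which f sends to p, is sent to j by g.\<close>
  have jgp: "j \<in> orbit g p"
  proof -
    define c where "c = card (orbit f p)"
    note en = orbit_enumeration[OF pf, of p, folded c_def]
    obtain k where k: "c = Suc k" using en(4) by (cases c) auto
    then have "(f ^^ k) p \<in> orbit g p" using en(3) sub by auto
    then have "g ((f ^^ k) p) \<in> orbit g p" by (rule orbit.step)
    moreover have "g ((f ^^ k) p) = j" using en(1) k by (simp add: g_def)
    ultimately show ?thesis by simp
  qed
  then have oj: "orbit g j = orbit g p"
    by (metis orbit_cyclic_eq3 cyclic_on_orbit' pg)
  have oth: "orbit g x = orbit f x" if "x \<notin> U" for x
    unfolding g_def using that orbit_transpose_comp_other[OF pf, of x p j] by (auto simp: U_def)
  have out: "x \<notin> U \<longleftrightarrow> orbit f x \<noteq> orbit f p \<and> orbit f x \<noteq> orbit f j" for x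
    unfolding U_def by (metis Un_iff orbit_cyclic_eq3 cyclic_on_orbit' pf permutation_self_in_orbit)
  \<comment> \<open>Outside U the orbits of g and f agree, so a point of \<open>orbit g p\<close>
    outside U would have p in its f-orbit and hence lie in U.\<close>
  have "orbit g p \<subseteq> U"
  proof
    fix x assume x: "x \<in> orbit g p"
    show "x \<in> U"
    proof (rule ccontr)
      assume "x \<notin> U"
      then have "orbit g x = orbit f x" by (rule oth)
      moreover have "p \<in> orbit g x"
        using x by (metis orbit_cyclic_eq3 cyclic_on_orbit' pg permutation_self_in_orbit)
      ultimately have "p \<in> orbit f x" by simp
      then have "orbit f x = orbit f p"
        by (metis orbit_cyclic_eq3 cyclic_on_orbit' pf)
      then show False using out[of x] \<open>x \<notin> U\<close> by simp
    qed
  qed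
  then have ogp: "orbit g p = U" using sub oj by (auto simp: U_def)
  have inU: "orbit g x = U" if "x \<in> U" for x
    using that ogp by (metis orbit_cyclic_eq3 cyclic_on_orbit' pg)
  show "orbit g ` V = insert U (orbit f ` V - {orbit f p, orbit f j})"
  proof (intro equalityI subsetI)
    fix X assume "X \<in> orbit g ` V"
    then obtain x where x: "x \<in> V" "X = orbit g x" by auto
    then show "X \<in> insert U (orbit f ` V - {orbit f p, orbit f j})"
      using inU[of x] oth[of x] out[of x] by (cases "x \<in> U") auto
  next
    fix X assume "X \<in> insert U (orbit f ` V - {orbit f p, orbit f j})"
    then consider "X = U" | x where "x \<in> V" "X = orbit f x" "x \<notin> U" using out by auto
    then show "X \<in> orbit g ` V"
    proof cases
      case 2
      then show ?thesis using oth[of x] by (metis imageI)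
    qed (use p ogp in auto)
  qed
qed

section \<open>Hyperbolic power series\<close>

text \<open>This is 2 sinh (a x / 2), with leading term a x; \<open>fcosh a\<close> is
  correspondingly 2 cosh (a x / 2). Several identities below carry a factor 2 on one side to avoid
  dividing by 2.\<close>

definition fsinh :: "real \<Rightarrow> real fps"
  where "fsinh a = fps_exp (a / 2) - fps_exp (- (a / 2))"

definition fcosh :: "real \<Rightarrow> real fps"
  where "fcosh a = fps_exp (a / 2) + fps_exp (- (a / 2))"

lemma fps_exp_diff_mult:
  "fps_exp (a - b) = fps_exp a * fps_exp (- b :: 'a :: field_char_0)"
  using fps_exp_add_mult[of a "- b"] by simp

lemma fsinh_0 [simp]: "fsinh 0 = 0"
  by (simp add: fsinh_def)

lemma fsinh_minus: "fsinh (- a) = - fsinh a"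
  by (simp add: fsinh_def)

lemma fsinh_add: "2 * fsinh (a + b) = fsinh a * fcosh b + fcosh a * fsinh b"
  unfolding fsinh_def fcosh_def add_divide_distrib minus_add_distrib fps_exp_add_mult
  by (simp add: algebra_simps)

lemma fsinh_fcosh: "fsinh a * fcosh b = fsinh (b + a) - fsinh (b - a)"
  unfolding fsinh_def fcosh_def add_divide_distrib diff_divide_distrib minus_add_distrib
    minus_diff_eq fps_exp_add_mult fps_exp_diff_mult
  by (simp add: algebra_simps)

lemma fsinh_fsinh: "fsinh a * fsinh b = fcosh (a + b) - fcosh (a - b)"
  unfolding fsinh_def fcosh_def add_divide_distrib diff_divide_distrib minus_add_distrib
    minus_diff_eq fps_exp_add_mult fps_exp_diff_mult
  by (simp add: algebra_simps)

lemma fsinh_pred: "2 * fsinh (a - 1) = fsinh a * fcosh 1 - fcosh a * fsinh 1"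
  using fsinh_fcosh[of a 1] fsinh_fcosh[of 1 a] fsinh_minus[of "a - 1"]
  by (simp add: algebra_simps)

lemma deriv_fsinh: "2 * fps_deriv (fsinh (real n)) = of_nat n * fcosh (real n)"
proof -
  have "2 * fps_const (real n / 2) = of_nat n"
    unfolding numeral_fps_const fps_const_mult by (simp add: fps_of_nat)
  moreover have "fps_deriv (fsinh (real n)) = fps_const (real n / 2) * fcosh (real n)"
    unfolding fsinh_def fcosh_def by (simp add: algebra_simps flip: fps_const_neg)
  ultimately show ?thesis by (simp add: mult.assoc[symmetric])
qed

lemma fsinh_1_nth: "fsinh 1 $ 0 = 0" "fsinh 1 $ 1 = 1" "fsinh 1 \<noteq> 0"
proof -
  show "fsinh 1 $ 0 = 0" and *: "fsinh 1 $ 1 = 1" by (simp_all add: fsinh_def)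
  show "fsinh 1 \<noteq> 0" using * by auto
qed

text \<open>The induction step writes \<open>fsinh (n + 1)\<close> as \<open>fsinh n\<close> times
  an exponential plus an exponential times \<open>fsinh 1\<close>. It makes the later divisions by
  \<open>fsinh 1\<close> exact.\<close>

lemma fsinh_1_dvd: "fsinh 1 dvd fsinh (real n)"
proof (induction n)
  case (Suc n)
  have "fsinh (real (Suc n)) = fsinh (real n) * fps_exp (1 / 2) + fps_exp (- (real n / 2)) * fsinh 1"
    unfolding fsinh_def of_nat_Suc add_divide_distrib minus_add_distrib fps_exp_add_mult
    by (simp add: algebra_simps)
  then show ?case using Suc by simp
qed simp

text \<open>This sums over all ways to cut a cycle of length c. The product formula turns each term
  into \<open>fcosh c\<close> minus \<open>fcosh (2 b - c)\<close>, and multiplied by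
  \<open>fsinh 1\<close> the second kind telescopes.\<close>

lemma fsinh_convolution:
  assumes "0 < c"
  shows "fsinh 1 * (\<Sum>b\<in>{1..<c}. fsinh (real b) * fsinh (real (c - b)))
    = of_nat c * fsinh 1 * fcosh (real c) - fcosh 1 * fsinh (real c)"
proof -
  have tel: "(\<Sum>b\<in>{1..<Suc k}. fsinh 1 * fcosh (2 * real b - real c))
      = fsinh (2 * real k + 1 - real c) - fsinh (1 - real c)" for k
    by (induction k) (simp_all add: fsinh_fcosh algebra_simps)
  obtain k where k: "c = Suc k" using assms by (cases c) auto
  have "fsinh 1 * (\<Sum>b\<in>{1..<c}. fsinh (real b) * fsinh (real (c - b)))
      = (\<Sum>b\<in>{1..<c}. fsinh 1 * fcosh (real c) - fsinh 1 * fcosh (2 * real b - real c))"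
    unfolding sum_distrib_left
    by (intro sum.cong) (simp_all add: fsinh_fsinh of_nat_diff algebra_simps)
  also have "\<dots> = of_nat k * fsinh 1 * fcosh (real c) - (fsinh (real k) - fsinh (1 - real c))"
    unfolding sum_subtractf using tel[of k] k by (simp add: algebra_simps)
  \<comment> \<open>Since c = k + 1, both ends of the telescoping sum are \<open>fsinh k\<close> up
    to sign; \<open>fsinh_pred\<close> then expands twice this value.\<close>
  also have "fsinh (1 - real c) = - fsinh (real k)"
    using k fsinh_minus[of "real k"] by simp
  also have "of_nat k * fsinh 1 * fcosh (real c) - (fsinh (real k) - - fsinh (real k))
      = of_nat c * fsinh 1 * fcosh (real c) - fcosh 1 * fsinh (real c)"
    using k fsinh_pred[of "real c"] by (simp add: algebra_simps)
  finally show ?thesis .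
qed

lemma deriv_prod_fsinh:
  assumes "finite A"
  shows "2 * fps_deriv (\<Prod>D\<in>A. fsinh (real (h D)))
    = (\<Sum>D\<in>A. of_nat (h D) * fcosh (real (h D)) * (\<Prod>E\<in>A - {D}. fsinh (real (h E))))"
  using assms
proof (induction A)
  case (insert x A)
  let ?S = "\<lambda>D. fsinh (real (h D))" and ?C = "\<lambda>D. of_nat (h D) * fcosh (real (h D))"
  have "(\<Sum>D\<in>A. ?C D * (\<Prod>E\<in>insert x A - {D}. ?S E)) = (\<Sum>D\<in>A. ?S x * (?C D * (\<Prod>E\<in>A - {D}. ?S E)))"
  proof (intro sum.cong refl)
    fix D assume "D \<in> A"
    then have "insert x A - {D} = insert x (A - {D})" using insert by auto
    then show "?C D * (\<Prod>E\<in>insert x A - {D}. ?S E) = ?S x * (?C D * (\<Prod>E\<in>A - {D}. ?S E))"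
      using insert by (simp add: algebra_simps)
  qed
  then have "(\<Sum>D\<in>insert x A. ?C D * (\<Prod>E\<in>insert x A - {D}. ?S E))
      = ?C x * (\<Prod>E\<in>A. ?S E) + ?S x * (2 * fps_deriv (\<Prod>D\<in>A. ?S D))"
    using insert by (simp add: sum_distrib_left)
  also have "?C x = 2 * fps_deriv (?S x)" by (simp add: deriv_fsinh)
  finally show ?case using insert by (simp add: algebra_simps)
qed simp

section \<open>Cycle series of a permutation and their sums over transpositions\<close>

definition cycle_series :: "'a set \<Rightarrow> ('a \<Rightarrow> 'a) \<Rightarrow> real fps"
  where "cycle_series V f = (\<Prod>D\<in>orbit f ` V. fsinh (real (card D)))"

text \<open>For an orbit P this is the cycle series with the factor of P removed; a separate product
  avoids a quotient of power series.\<close>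

definition cocycle_series :: "'a set \<Rightarrow> ('a \<Rightarrow> 'a) \<Rightarrow> 'a set \<Rightarrow> real fps"
  where "cocycle_series V f P = (\<Prod>D\<in>orbit f ` V - {P}. fsinh (real (card D)))"

lemma cycle_series_split:
  assumes "finite V" "p \<in> V"
  shows "cycle_series V f = fsinh (real (card (orbit f p))) * cocycle_series V f (orbit f p)"
  unfolding cycle_series_def cocycle_series_def
  using assms by (subst prod.remove[of _ "orbit f p"]) auto

lemma cycle_series_cut:
  assumes "f permutes V" "finite V" "p \<in> V" "0 < b" "b < card (orbit f p)"
  shows "cycle_series V (transpose ((f ^^ b) p) p \<circ> f)
    = fsinh (real b) * fsinh (real (card (orbit f p) - b)) * cocycle_series V f (orbit f p)"
proof -
  obtain A B where AB:
    "orbit (transpose ((f ^^ b) p) p \<circ> f) ` V = insert A (insert B (orbit f ` V - {orbit f p}))"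
    "A \<noteq> B" "A \<notin> orbit f ` V - {orbit f p}" "B \<notin> orbit f ` V - {orbit f p}"
    "card A = b" "card B = card (orbit f p) - b"
    by (rule orbits_transpose_cut[OF assms])
  have "finite (orbit f ` V - {orbit f p})" using assms by simp
  then show ?thesis
    unfolding cycle_series_def cocycle_series_def AB(1)
    using AB(2-6) by (simp add: mult.assoc)
qed

lemma sum_orbits:
  assumes f: "f permutes V" "finite V"
  shows "(\<Sum>x\<in>V. h (orbit f x)) = (\<Sum>D\<in>orbit f ` V. of_nat (card D) * (h D :: 'b :: comm_semiring_1))"
proof -
  have pf: "permutation f" using f by (auto simp: permutation_permutes)
  have "(\<Sum>x\<in>V. h (orbit f x)) = (\<Sum>D\<in>orbit f ` V. \<Sum>x\<in>{x \<in> V. orbit f x = D}. h (orbit f x))"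
    by (rule sum.image_gen[OF f(2)])
  also have "\<dots> = (\<Sum>D\<in>orbit f ` V. of_nat (card D) * h D)"
  proof (intro sum.cong refl)
    fix D assume "D \<in> orbit f ` V"
    then obtain y where y: "y \<in> V" "D = orbit f y" by auto
    have "x \<in> D \<longleftrightarrow> x \<in> V \<and> orbit f x = D" for x
      using y permutes_orbit_subset[OF f(1) y(1)] permutation_self_in_orbit[OF pf, of x]
        orbit_cyclic_eq3[OF cyclic_on_orbit'[OF pf, of y], of x] by auto
    then have "{x \<in> V. orbit f x = D} = D" by auto
    moreover have "(\<Sum>x\<in>{x \<in> V. orbit f x = D}. h (orbit f x)) = (\<Sum>x\<in>{x \<in> V. orbit f x = D}. h D)"
      by (intro sum.cong) auto
    ultimately show "(\<Sum>x\<in>{x \<in> V. orbit f x = D}. h (orbit f x)) = of_nat (card D) * h D" by simp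
  qed
  finally show ?thesis .
qed

text \<open>Each j in the cycle of p other than p is f^b p for exactly one b with 0 < b <
  \<open>card P\<close>, and cuts that cycle into lengths b and \<open>card P - b\<close>; the
  convolution formula evaluates the sum.\<close>

lemma sum_cycle_series_same_orbit:
  assumes f: "f permutes V" "finite V" and p: "p \<in> V"
  defines "P \<equiv> orbit f p"
  shows "fsinh 1 * (\<Sum>j\<in>P - {p}. cycle_series V (transpose j p \<circ> f))
    = (of_nat (card P) * fsinh 1 * fcosh (real (card P)) - fcosh 1 * fsinh (real (card P)))
      * cocycle_series V f P"
proof -
  have pf: "permutation f" using f by (auto simp: permutation_permutes)
  note en = orbit_enumeration[OF pf, of p, folded P_def]
  have split: "{0..<card P} = insert 0 {1..<card P}" using en(4) by auto
  have inj: "inj_on (\<lambda>k. (f ^^ k) p) {1..<card P}"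
    by (rule inj_on_subset[OF en(2)]) auto
  have im: "P - {p} = (\<lambda>k. (f ^^ k) p) ` {1..<card P}"
  proof -
    have "P = insert p ((\<lambda>k. (f ^^ k) p) ` {1..<card P})" using en(3) split by simp
    moreover have "p \<notin> (\<lambda>k. (f ^^ k) p) ` {1..<card P}"
      using inj_onD[OF en(2), of 0] by force
    ultimately show ?thesis by (metis Diff_insert_absorb)
  qed
  have "(\<Sum>j\<in>P - {p}. cycle_series V (transpose j p \<circ> f))
      = (\<Sum>b\<in>{1..<card P}. cycle_series V (transpose ((f ^^ b) p) p \<circ> f))"
    unfolding im sum.reindex[OF inj] by simp
  also have "\<dots> = (\<Sum>b\<in>{1..<card P}. fsinh (real b) * fsinh (real (card P - b))) * cocycle_series V f P"
    unfolding sum_distrib_right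
    using cycle_series_cut[OF f p] by (intro sum.cong) (auto simp: P_def)
  finally show ?thesis
    using fsinh_convolution[OF en(4)] by (simp add: mult.assoc[symmetric])
qed

text \<open>A cycle D other than P is joined to P by \<open>card D\<close> choices of j. The
  addition theorem splits the new factor in two: one half gives the Leibniz terms of the derivative
  with the term of P missing, the other gives a common term with total weight
  \<open>card V - card P\<close>. Both deficits are moved to the left, whence the factor
  \<open>2 * of_nat (card P)\<close>.\<close>

lemma sum_cycle_series_other_orbits:
  assumes f: "f permutes V" "finite V" and p: "p \<in> V"
  defines "P \<equiv> orbit f p"
  shows "2 * (\<Sum>j\<in>V - P. cycle_series V (transpose j p \<circ> f)) + 2 * of_nat (card P) * fcosh (real (card P)) * cocycle_series V f P
    = 2 * fps_deriv (cycle_series V f) + of_nat (card V) * fcosh (real (card P)) * cocycle_series V f P"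
proof -
  have pf: "permutation f" using f by (auto simp: permutation_permutes)
  define Os where "Os = orbit f ` V"
  have Os: "finite Os" "P \<in> Os" using f p by (auto simp: Os_def P_def)
  define S where "S D = fsinh (real (card D))" for D :: "'a set"
  define C where "C D = fcosh (real (card D))" for D :: "'a set"
  define n :: "'a set \<Rightarrow> real fps" where "n D = of_nat (card D)" for D
  define R where "R = cocycle_series V f P"
  have R: "R = prod S (Os - {P})" by (simp add: R_def cocycle_series_def Os_def S_def)
  \<comment> \<open>The value 0 at P lets the sum over \<open>V - P\<close> extend to all of V,
    where it can be grouped by orbits.\<close>
  define h where "h D = (if D = P then 0 else fsinh (real (card P + card D)) * prod S (Os - {P, D}))" for D
  have mem: "j \<in> P \<longleftrightarrow> orbit f j = P" for j
    unfolding P_def by (metis orbit_cyclic_eq3 cyclic_on_orbit' pf permutation_self_in_orbit)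
  have PV: "P \<subseteq> V" unfolding P_def by (rule permutes_orbit_subset[OF f(1) p])
  have "(\<Sum>j\<in>V - P. cycle_series V (transpose j p \<circ> f)) = (\<Sum>j\<in>V - P. h (orbit f j))"
  proof (intro sum.cong refl)
    fix j assume j: "j \<in> V - P"
    then have j': "j \<in> V" "j \<notin> orbit f p" by (auto simp: P_def)
    note jn = orbits_transpose_join[OF f p j', folded Os_def]
    have "orbit f j \<noteq> P" using j mem by auto
    then show "cycle_series V (transpose j p \<circ> f) = h (orbit f j)"
      using jn(2,3) Os(1) by (simp add: cycle_series_def jn(1) h_def S_def P_def)
  qed
  also have "\<dots> = (\<Sum>j\<in>V. h (orbit f j))"
    using f mem by (intro sum.mono_neutral_left) (auto simp: h_def)
  also have "\<dots> = (\<Sum>D\<in>Os. n D * h D)"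
    unfolding Os_def n_def by (rule sum_orbits[OF f])
  also have "\<dots> = (\<Sum>D\<in>Os - {P}. n D * h D)"
    using Os by (intro sum.mono_neutral_right) (auto simp: h_def)
  finally have "2 * (\<Sum>j\<in>V - P. cycle_series V (transpose j p \<circ> f)) = (\<Sum>D\<in>Os - {P}. n D * (2 * h D))"
    by (simp add: sum_distrib_left mult.left_commute)
  also have "\<dots> = (\<Sum>D\<in>Os - {P}. n D * C D * prod S (Os - {D}) + n D * (C P * R))"
  proof (intro sum.cong refl)
    fix D assume D: "D \<in> Os - {P}"
    have "prod S (Os - {P}) = S D * prod S (Os - {P} - {D})"
      using D Os by (subst prod.remove[of _ D]) auto
    also have "Os - {P} - {D} = Os - {P, D}" by auto
    finally have 1: "R = S D * prod S (Os - {P, D})" using R by simp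
    have "prod S (Os - {D}) = S P * prod S (Os - {D} - {P})"
      using D Os by (subst prod.remove[of _ P]) auto
    also have "Os - {D} - {P} = Os - {P, D}" by auto
    finally have 2: "prod S (Os - {D}) = S P * prod S (Os - {P, D})" .
    have "2 * h D = (2 * fsinh (real (card P) + real (card D))) * prod S (Os - {P, D})"
      using D by (simp add: h_def)
    also have "\<dots> = (S P * C D + C P * S D) * prod S (Os - {P, D})"
      unfolding fsinh_add by (simp add: S_def C_def)
    finally show "n D * (2 * h D) = n D * C D * prod S (Os - {D}) + n D * (C P * R)"
      unfolding 1 2 by (simp add: algebra_simps)
  qed
  also have "\<dots> = (\<Sum>D\<in>Os - {P}. n D * C D * prod S (Os - {D})) + (\<Sum>D\<in>Os - {P}. n D) * (C P * R)"
    by (simp add: sum.distrib sum_distrib_right)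
  finally have main: "2 * (\<Sum>j\<in>V - P. cycle_series V (transpose j p \<circ> f)) = \<dots>" .
  have "2 * fps_deriv (cycle_series V f) = (\<Sum>D\<in>Os. n D * C D * prod S (Os - {D}))"
    unfolding cycle_series_def Os_def[symmetric] n_def C_def S_def
    by (rule deriv_prod_fsinh[OF Os(1)])
  also have "\<dots> = n P * C P * R + (\<Sum>D\<in>Os - {P}. n D * C D * prod S (Os - {D}))"
    using Os R by (subst sum.remove[of _ P]) auto
  finally have deriv: "2 * fps_deriv (cycle_series V f) = \<dots>" .
  have "of_nat (card V) = (\<Sum>D\<in>Os. n D)"
    using sum_orbits[OF f, of "\<lambda>_. 1 :: real fps"] by (simp add: Os_def n_def)
  also have "\<dots> = n P + (\<Sum>D\<in>Os - {P}. n D)"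
    using Os by (subst sum.remove[of _ P]) auto
  finally have cardV: "(of_nat (card V) :: real fps) = \<dots>" .
  show ?thesis
    unfolding main deriv cardV R_def[symmetric] n_def[of P, symmetric] C_def[of P, symmetric]
    by (simp add: algebra_simps)
qed

text \<open>The terms weighted by the length of the pivot's cycle cancel between the same-orbit and
  other-orbit sums. The factor \<open>fsinh 1\<close> stays because the convolution is evaluated
  only after multiplication by it.\<close>

lemma sum_cycle_series_pivot:
  assumes f: "f permutes V" "finite V" and p: "p \<in> V"
  defines "P \<equiv> orbit f p"
  shows "2 * fsinh 1 * (\<Sum>j\<in>V - {p}. cycle_series V (transpose j p \<circ> f))
    = 2 * fsinh 1 * fps_deriv (cycle_series V f) - 2 * fcosh 1 * cycle_series V f
      + of_nat (card V) * fcosh (real (card P)) * fsinh 1 * cocycle_series V f P"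
proof -
  have pf: "permutation f" using f by (auto simp: permutation_permutes)
  define X where "X A = (\<Sum>j\<in>A. cycle_series V (transpose j p \<circ> f))" for A
  have "V - {p} = (P - {p}) \<union> (V - P)" "(P - {p}) \<inter> (V - P) = {}" "P \<subseteq> V"
    using permutes_orbit_subset[OF f(1) p] permutation_self_in_orbit[OF pf, of p] by (auto simp: P_def)
  then have split: "X (V - {p}) = X (P - {p}) + X (V - P)"
    using f(2) by (simp add: X_def sum.union_disjoint finite_subset)
  have same: "fsinh 1 * X (P - {p})
      = (of_nat (card P) * fsinh 1 * fcosh (real (card P)) - fcosh 1 * fsinh (real (card P)))
        * cocycle_series V f P"
    unfolding X_def P_def by (rule sum_cycle_series_same_orbit[OF f p])
  have other: "2 * X (V - P) = 2 * fps_deriv (cycle_series V f)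
      + of_nat (card V) * fcosh (real (card P)) * cocycle_series V f P
      - 2 * of_nat (card P) * fcosh (real (card P)) * cocycle_series V f P"
    using sum_cycle_series_other_orbits[OF f p, folded P_def, folded X_def] by (simp add: eq_diff_eq)
  have "2 * fsinh 1 * X (V - {p}) = 2 * (fsinh 1 * X (P - {p})) + fsinh 1 * (2 * X (V - P))"
    unfolding split by (simp add: algebra_simps)
  also have "\<dots> = 2 * fsinh 1 * fps_deriv (cycle_series V f) - 2 * fcosh 1 * cycle_series V f
      + of_nat (card V) * fcosh (real (card P)) * fsinh 1 * cocycle_series V f P"
    unfolding same other cycle_series_split[OF f(2) p, of f, folded P_def]
    by (simp add: algebra_simps)
  finally show ?thesis by (simp add: X_def)
qed

text \<open>The division is exact for nonempty \<open>V\<close>.\<close>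

definition reduced_series :: "'a set \<Rightarrow> ('a \<Rightarrow> 'a) \<Rightarrow> real fps"
  where "reduced_series V f = cycle_series V f div fsinh 1"

lemma reduced_series:
  assumes "finite V" "V \<noteq> {}"
  shows "cycle_series V f = fsinh 1 * reduced_series V f"
proof -
  obtain p where "p \<in> V" using assms by auto
  then have "fsinh 1 dvd cycle_series V f"
    unfolding cycle_series_split[OF assms(1) \<open>p \<in> V\<close>] using fsinh_1_dvd by simp
  then show ?thesis by (simp add: reduced_series_def)
qed

lemma deriv_fsinh_1: "2 * fps_deriv (fsinh 1) = fcosh 1"
  using deriv_fsinh[of 1] by simp

lemma deriv_cycle_series:
  assumes "finite V" "V \<noteq> {}"
  shows "2 * fps_deriv (cycle_series V f)
    = fcosh 1 * reduced_series V f + 2 * fsinh 1 * fps_deriv (reduced_series V f)"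
proof -
  have "2 * fps_deriv (cycle_series V f)
      = (2 * fps_deriv (fsinh 1)) * reduced_series V f + 2 * fsinh 1 * fps_deriv (reduced_series V f)"
    unfolding reduced_series[OF assms] by (simp add: algebra_simps)
  then show ?thesis unfolding deriv_fsinh_1 .
qed

text \<open>Differentiating the factor \<open>fsinh 1\<close> of the cycle series absorbs half of
  the term with \<open>2 * fcosh 1\<close>; afterwards one factor \<open>fsinh 1\<close> cancels
  throughout.\<close>

lemma sum_reduced_series_pivot:
  assumes f: "f permutes V" "finite V" and p: "p \<in> V"
  defines "P \<equiv> orbit f p"
  shows "2 * fsinh 1 * (\<Sum>j\<in>V - {p}. reduced_series V (transpose j p \<circ> f))
    = 2 * fsinh 1 * fps_deriv (reduced_series V f) - fcosh 1 * reduced_series V f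
      + of_nat (card V) * fcosh (real (card P)) * cocycle_series V f P"
proof -
  have V: "V \<noteq> {}" using p by auto
  define Y where "Y = (\<Sum>j\<in>V - {p}. reduced_series V (transpose j p \<circ> f))"
  have "fsinh 1 * (2 * fsinh 1 * Y)
      = 2 * fsinh 1 * (\<Sum>j\<in>V - {p}. cycle_series V (transpose j p \<circ> f))"
    unfolding Y_def reduced_series[OF f(2) V] sum_distrib_left[symmetric]
    by (simp add: mult_ac)
  also have "\<dots> = fsinh 1 * (2 * fps_deriv (cycle_series V f)) - 2 * fcosh 1 * cycle_series V f
      + of_nat (card V) * fcosh (real (card P)) * fsinh 1 * cocycle_series V f P"
    unfolding P_def sum_cycle_series_pivot[OF f p] by simp
  also have "\<dots> = fsinh 1 * (2 * fsinh 1 * fps_deriv (reduced_series V f) - fcosh 1 * reduced_series V f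
      + of_nat (card V) * fcosh (real (card P)) * cocycle_series V f P)"
    unfolding deriv_cycle_series[OF f(2) V] unfolding reduced_series[OF f(2) V]
    by (simp add: algebra_simps)
  finally show ?thesis
    unfolding Y_def using fsinh_1_nth(3) by simp
qed

text \<open>Summed over pivots and grouped by cycles, the last terms of the pivot formula form the
  Leibniz derivative of the cycle series. Its part \<open>fcosh 1 * Q\<close> cancels the negative
  one and its other part doubles Q'. Every transposition occurs twice in the double sum.\<close>

lemma sum_reduced_series_transpositions:
  assumes f: "f permutes V" "finite V"
  shows "(\<Sum>p\<in>V. \<Sum>j\<in>V - {p}. reduced_series V (transpose j p \<circ> f))
    = 2 * of_nat (card V) * fps_deriv (reduced_series V f)"
proof (cases "V = {}")
  case False
  define Q where "Q = reduced_series V f"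
  define Y where "Y = (\<Sum>p\<in>V. \<Sum>j\<in>V - {p}. reduced_series V (transpose j p \<circ> f))"
  have "2 * fsinh 1 * Y = (\<Sum>p\<in>V. 2 * fsinh 1 * fps_deriv Q - fcosh 1 * Q
      + of_nat (card V) * (fcosh (real (card (orbit f p))) * cocycle_series V f (orbit f p)))"
    unfolding Y_def sum_distrib_left[of _ _ V] Q_def
    using sum_reduced_series_pivot[OF f] by (intro sum.cong) (auto simp: mult.assoc)
  also have "\<dots> = of_nat (card V) * (2 * fsinh 1 * fps_deriv Q - fcosh 1 * Q)
      + of_nat (card V) * (\<Sum>p\<in>V. fcosh (real (card (orbit f p))) * cocycle_series V f (orbit f p))"
    by (simp add: sum.distrib sum_distrib_left)
  also have "(\<Sum>p\<in>V. fcosh (real (card (orbit f p))) * cocycle_series V f (orbit f p))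
      = 2 * fps_deriv (cycle_series V f)"
    unfolding sum_orbits[OF f, of "\<lambda>D. fcosh (real (card D)) * cocycle_series V f D"]
    unfolding cycle_series_def cocycle_series_def
    using deriv_prod_fsinh[of "orbit f ` V" card] f(2) by (simp add: mult.assoc)
  also have "\<dots> = fcosh 1 * Q + 2 * fsinh 1 * fps_deriv Q"
    unfolding Q_def by (rule deriv_cycle_series[OF f(2) False])
  finally have "(2 * fsinh 1) * Y = (2 * fsinh 1) * (2 * of_nat (card V) * fps_deriv Q)"
    by (simp add: algebra_simps)
  moreover have "2 * fsinh 1 \<noteq> 0" using fsinh_1_nth(3) by simp
  ultimately have "Y = 2 * of_nat (card V) * fps_deriv Q" using mult_left_cancel by blast
  then show ?thesis unfolding Y_def Q_def .
qed simp

section \<open>Star series and their differential recursion\<close>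

text \<open>The divisor \<open>fact (card V)\<close> of the generating function is left out; in the
  recursion it shows as the factor \<open>of_nat (card V)\<close> on the terms that remove a
  point.\<close>

definition star_series :: "'a set \<Rightarrow> ('a \<Rightarrow> 'a) \<Rightarrow> real fps"
  where "star_series V f = fsinh 1 ^ (card V - 1) * reduced_series V f"

text \<open>As f i = p, the point i is the last one of the cycle of p, and the transposition cuts it
  off as a fixed point. Removing i from V then deletes one factor \<open>fsinh 1\<close>.\<close>

lemma reduced_series_remove:
  assumes f: "f permutes V" "finite V" and p: "p \<in> V" and i: "i \<in> V" "i \<noteq> p" "f i = p"
  shows "fsinh 1 * reduced_series (V - {i}) (transpose i p \<circ> f)
    = fsinh (real (card (orbit f p)) - 1) * cocycle_series V f (orbit f p)"
proof -
  have pf: "permutation f" using f by (auto simp: permutation_permutes)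
  define c where "c = card (orbit f p)"
  define g where "g = transpose i p \<circ> f"
  note en = orbit_enumeration[OF pf, of p, folded c_def]
  have "p \<in> orbit f i" using i(3) orbit.base[of f i] by simp
  then have "i \<in> orbit f p"
    by (metis orbit_swap permutation_self_in_orbit pf)
  then obtain k where k: "k < c" "i = (f ^^ k) p" using en(3) by auto
  have "(f ^^ Suc k) p = p" using k i by simp
  \<comment> \<open>A return to p before exponent c would contradict injectivity of the enumeration,
    so i has exponent c - 1.\<close>
  then have "\<not> Suc k < c"
    using inj_onD[OF en(2), of "Suc k" 0] by fastforce
  then have c: "c = Suc k" using k by simp
  have k0: "0 < k" using k i by (cases k) auto
  have "k < card (orbit f p)" using c by (simp add: c_def)
  note cut = cycle_series_cut[OF f p k0 this, folded k(2), folded g_def]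
  have gi: "g i = i" using i by (simp add: g_def)
  then have oi: "orbit g i = {i}" by (simp add: orbit_eq_singleton_iff)
  have pg: "permutation g"
    unfolding g_def using permutation_transpose_comp[OF f i(1) p] by auto
  have "orbit g ` V = insert {i} (orbit g ` (V - {i}))"
    using i(1) oi by (metis image_insert insert_Diff)
  moreover have "{i} \<notin> orbit g ` (V - {i})"
    using permutation_self_in_orbit[OF pg] by (metis DiffE imageE singletonD singletonI)
  ultimately have "cycle_series V g = fsinh 1 * cycle_series (V - {i}) g"
    using f(2) by (simp add: cycle_series_def)
  also have "cycle_series (V - {i}) g = fsinh 1 * reduced_series (V - {i}) g"
    using f(2) p i(2) by (intro reduced_series) auto
  also have "cycle_series V g = fsinh 1 * (fsinh (real c - 1) * cocycle_series V f (orbit f p))"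
    unfolding cut c_def[symmetric] using c by simp
  finally have "fsinh 1 * (fsinh 1 * reduced_series (V - {i}) g)
      = fsinh 1 * (fsinh (real c - 1) * cocycle_series V f (orbit f p))" ..
  then show ?thesis
    unfolding mult_left_cancel[OF fsinh_1_nth(3)] g_def c_def .
qed

text \<open>The point i can leave the support only if \<open>transpose i p \<circ> f\<close> fixes
  it, that is if f i = p. By \<open>fsinh_pred\<close> the removal term cancels the
  \<open>fcosh c\<close> term of the pivot sum. What remains next to Q' is (n - 1)
  \<open>fcosh 1\<close> times Q, which is the contribution of the derivative of
  \<open>fsinh 1 ^ (n - 1)\<close>.\<close>

lemma deriv_star_series:
  assumes f: "f permutes V" "finite V" and p: "p \<in> V" and V: "2 \<le> card V"
  shows "fps_deriv (star_series V f) = (\<Sum>i\<in>V - {p}. star_series V (transpose i p \<circ> f))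
    + of_nat (card V) * (\<Sum>i\<in>{i \<in> V - {p}. f i = p}. star_series (V - {i}) (transpose i p \<circ> f))"
proof -
  \<comment> \<open>With m = \<open>card V\<close> - 2 the powers of \<open>fsinh 1\<close> in the
    star series over V and over \<open>V - {i}\<close> are \<open>Suc m\<close> and m.\<close>
  obtain m where m: "card V = Suc (Suc m)" using V by (metis One_nat_def Suc_1 Suc_le_D Suc_le_mono)
  have ne: "V \<noteq> {}" using p by auto
  define s where "s = fsinh 1"
  define Q where "Q = reduced_series V f"
  define c where "c = real (card (orbit f p))"
  define R where "R = cocycle_series V f (orbit f p)"
  define N where "N = (of_nat (card V) :: real fps)"
  define Y where "Y = (\<Sum>i\<in>V - {p}. reduced_series V (transpose i p \<circ> f))"
  define Z where "Z = (\<Sum>i\<in>{i \<in> V - {p}. f i = p}. reduced_series (V - {i}) (transpose i p \<circ> f))"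
  have s: "s \<noteq> 0" using fsinh_1_nth(3) by (simp add: s_def)
  have sQ: "s * Q = fsinh c * R"
    unfolding s_def Q_def c_def R_def
    using cycle_series_split[OF f(2) p] reduced_series[OF f(2) ne] by metis
  have Y: "2 * s * Y = 2 * s * fps_deriv Q - fcosh 1 * Q + N * fcosh c * R"
    unfolding Y_def s_def Q_def c_def R_def N_def by (rule sum_reduced_series_pivot[OF f p])
  \<comment> \<open>If p is fixed, no i is removable and \<open>fsinh (c - 1)\<close> is
    \<open>fsinh 0\<close>, so both sides vanish; otherwise the preimage of p is the only removable
    point.\<close>
  have Z: "s * Z = fsinh (c - 1) * R"
  proof (cases "f p = p")
    case True
    then have "c = 1" by (simp add: c_def orbit_eq_singleton_iff[THEN iffD2])
    moreover have "{i \<in> V - {p}. f i = p} = {}"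
      using True permutes_inj[OF f(1)] by (auto simp: inj_def)
    ultimately show ?thesis by (simp only: Z_def) simp
  next
    case False
    obtain i where i: "f i = p" using permutes_surj[OF f(1)] by (metis surjD)
    then have i': "i \<in> V" "i \<noteq> p" using permutes_in_image[OF f(1), of i] p False by auto
    then have "{i \<in> V - {p}. f i = p} = {i}"
      using i permutes_inj[OF f(1)] by (auto simp: inj_def)
    then show ?thesis
      using reduced_series_remove[OF f p i' i] by (simp add: Z_def s_def c_def R_def)
  qed
  have star: "star_series V (transpose i p \<circ> f) = s ^ Suc m * reduced_series V (transpose i p \<circ> f)" for i
    by (simp add: star_series_def m s_def)
  have star': "star_series (V - {i}) (transpose i p \<circ> f)
      = s ^ m * reduced_series (V - {i}) (transpose i p \<circ> f)" if "i \<in> V" for i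
    using that f(2) by (simp add: star_series_def m s_def)
  have Y': "(\<Sum>i\<in>V - {p}. star_series V (transpose i p \<circ> f)) = s ^ Suc m * Y"
    unfolding star Y_def by (rule sum_distrib_left[symmetric])
  have Z': "(\<Sum>i\<in>{i \<in> V - {p}. f i = p}. star_series (V - {i}) (transpose i p \<circ> f)) = s ^ m * Z"
    unfolding Z_def sum_distrib_left by (intro sum.cong) (auto simp: star')
  have N: "N = 2 + of_nat m" by (simp add: N_def m)
  have ds: "2 * fps_deriv s = fcosh 1" unfolding s_def by (rule deriv_fsinh_1)
  have "fps_deriv (s ^ Suc m) = of_nat (Suc m) * fps_deriv s * s ^ m"
    by (subst fps_deriv_power) (simp add: fps_of_nat del: of_nat_Suc power_Suc)
  then have "2 * fps_deriv (s ^ Suc m * Q)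
      = of_nat (Suc m) * (2 * fps_deriv s) * s ^ m * Q + 2 * s ^ Suc m * fps_deriv Q"
    by (simp only: fps_deriv_mult) (simp add: algebra_simps)
  moreover have "star_series V f = s ^ Suc m * Q" by (simp add: star_series_def m s_def Q_def)
  ultimately have dA: "2 * fps_deriv (star_series V f)
      = (N - 1) * fcosh 1 * s ^ m * Q + 2 * s ^ Suc m * fps_deriv Q"
    using ds by (simp add: N)
  have Z2: "2 * (s * Z) = fcosh 1 * (s * Q) - fcosh c * s * R"
  proof -
    have "2 * (s * Z) = (2 * fsinh (c - 1)) * R" unfolding Z by (rule mult.assoc[symmetric])
    then show ?thesis unfolding fsinh_pred s_def[symmetric] sQ by (simp add: algebra_simps)
  qed
  have "2 * s * fps_deriv (star_series V f) = s * (2 * fps_deriv (star_series V f))"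
    unfolding mult.commute[of 2 s] mult.assoc ..
  also have "\<dots> = s ^ Suc m * (2 * s * Y) + N * s ^ m * (2 * (s * Z))"
    unfolding dA Y Z2 by (simp add: algebra_simps)
  finally have "(2 * s) * fps_deriv (star_series V f) = (2 * s) * (s ^ Suc m * Y + N * (s ^ m * Z))"
    by (simp add: algebra_simps)
  then have "fps_deriv (star_series V f) = s ^ Suc m * Y + N * (s ^ m * Z)"
    using s by simp
  then show ?thesis unfolding Y' Z' N_def .
qed

section \<open>Vanishing and explicit coefficients\<close>

text \<open>Every cycle contributes a multiple of \<open>fsinh 1\<close>, and the division uses up
  one of them; the remaining power of \<open>fsinh 1\<close> has no terms of lower order.\<close>

lemma reduced_series_low_order:
  assumes "finite V" "k + 1 < card (orbit f ` V)"
  shows "reduced_series V f $ k = 0"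
proof -
  have V: "V \<noteq> {}" using assms by auto
  have "\<exists>u. \<forall>n. fsinh (real n) = fsinh 1 * u n"
    using fsinh_1_dvd unfolding dvd_def by metis
  then obtain u where u: "\<And>n. fsinh (real n) = fsinh 1 * u n" by blast
  obtain m where m: "card (orbit f ` V) = Suc m" using assms by (metis less_imp_Suc_add)
  have "fsinh 1 * reduced_series V f = fsinh 1 ^ card (orbit f ` V) * (\<Prod>D\<in>orbit f ` V. u (card D))"
    unfolding reduced_series[OF assms(1) V, symmetric] cycle_series_def u prod.distrib by simp
  then have "reduced_series V f = fsinh 1 ^ m * (\<Prod>D\<in>orbit f ` V. u (card D))"
    using fsinh_1_nth(3) by (simp add: m mult.assoc)
  moreover have "(fsinh 1 ^ m) $ i = 0" if "i \<le> k" for i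
    using that startsby_zero_power_prefix[OF fsinh_1_nth(1), of m] assms(2) m by simp
  ultimately show ?thesis by (simp add: fps_mult_nth)
qed

text \<open>The binomial expansion of the power is a combination of exponentials with exponents m/2
  - j; this is the source of the alternating sum in the final formula.\<close>

lemma fsinh_1_power_nth:
  "(fsinh 1 ^ m) $ k = (\<Sum>j\<le>m. real (m choose j) * (- 1) ^ j * (real m / 2 - real j) ^ k) / fact k"
proof -
  have "fsinh 1 = - fps_exp (- (1 / 2)) + fps_exp (1 / 2)" by (simp add: fsinh_def)
  then have "fsinh 1 ^ m = (\<Sum>j\<le>m. of_nat (m choose j) * (- fps_exp (- (1 / 2))) ^ j * fps_exp (1 / 2) ^ (m - j))"
    by (simp only: binomial_ring)
  also have "\<dots> = (\<Sum>j\<le>m. fps_const (real (m choose j) * (- 1) ^ j) * fps_exp (real m / 2 - real j))"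
  proof (intro sum.cong refl)
    fix j assume j: "j \<in> {..m}"
    have "(- fps_exp (- (1 / 2) :: real)) ^ j = (- 1) ^ j * fps_exp (- (real j / 2))"
      by (subst power_minus) (simp add: fps_exp_power_mult)
    moreover have "fps_exp (1 / 2 :: real) ^ (m - j) = fps_exp (real m / 2 - real j / 2)"
      using j by (simp add: fps_exp_power_mult of_nat_diff diff_divide_distrib)
    moreover have "fps_exp (- (real j / 2)) * fps_exp (real m / 2 - real j / 2) = fps_exp (real m / 2 - real j)"
      by (simp add: fps_exp_add_mult[symmetric])
    moreover have "(fps_const ((- 1) ^ j) :: real fps) = (- 1) ^ j"
      by (cases "even j") (simp_all flip: fps_const_neg)
    ultimately show "of_nat (m choose j) * (- fps_exp (- (1 / 2))) ^ j * fps_exp (1 / 2) ^ (m - j)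
        = fps_const (real (m choose j) * (- 1) ^ j) * fps_exp (real m / 2 - real j)"
      by (simp add: fps_of_nat mult.assoc flip: fps_const_mult)
  qed
  finally show ?thesis by (simp add: fps_sum_nth sum_divide_distrib)
qed

text \<open>\<open>fsinh 1\<close> is an odd series. In the coefficient formula the reflection of j
  to m - j negates the base m/2 - j and changes the sign (-1)^j to (-1)^(m-j), so the sum equals its
  own negative.\<close>

lemma fsinh_1_power_parity:
  assumes "odd (m + k)"
  shows "(fsinh 1 ^ m) $ k = 0"
proof -
  define t where "t j = real (m choose j) * (- 1) ^ j * (real m / 2 - real j) ^ k" for j
  have "(\<Sum>j\<le>m. t j) = (\<Sum>j\<le>m. t (m - j))"
    by (rule sum.nat_diff_reindex[symmetric, of t "Suc m", unfolded lessThan_Suc_atMost, simplified])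
  also have "\<dots> = (\<Sum>j\<le>m. - t j)"
  proof (intro sum.cong refl)
    fix j assume j: "j \<in> {..m}"
    have "real m / 2 - real (m - j) = - (real m / 2 - real j)" using j by (simp add: of_nat_diff field_simps)
    then have pw: "(real m / 2 - real (m - j)) ^ k = (- 1) ^ k * (real m / 2 - real j) ^ k"
      by (simp only: power_minus[of "real m / 2 - real j"])
    have pm: "(- 1 :: real) ^ (m - j) * (- 1) ^ k = - ((- 1) ^ j)"
      using assms j by (cases "even m"; cases "even j") auto
    have "t (m - j) = real (m choose j) * (- 1) ^ (m - j) * (real m / 2 - real (m - j)) ^ k"
      using j by (simp add: t_def binomial_symmetric[symmetric])
    also have "\<dots> = real (m choose j) * ((- 1) ^ (m - j) * (- 1) ^ k) * (real m / 2 - real j) ^ k"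
      unfolding pw by (simp only: mult.assoc)
    also have "\<dots> = - t j"
      unfolding pm by (simp add: t_def)
    finally show "t (m - j) = - t j" .
  qed
  finally have "(\<Sum>j\<le>m. t j) = 0" by (simp add: sum_negf)
  then show ?thesis by (simp add: fsinh_1_power_nth t_def)
qed

section \<open>Counting factorizations\<close>

lemma transpose_comp_eq_iff: "transpose i j \<circ> h = f \<longleftrightarrow> h = transpose i j \<circ> f"
  by (auto simp: fun_eq_iff) (metis transpose_involutory)+

text \<open>The carrier \<open>V\<close> is arbitrary because the recursion removes elements from the support.\<close>

definition star_words :: "'a set \<Rightarrow> 'a \<Rightarrow> nat \<Rightarrow> ('a \<Rightarrow> 'a) \<Rightarrow> 'a list set"
  where "star_words V p r f =
    {xs. length xs = r \<and> set xs = V - {p} \<and> foldr (\<circ>) (map (\<lambda>i. transpose i p) xs) id = f}"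

lemma finite_star_words: "finite V \<Longrightarrow> finite (star_words V p r f)"
  by (rule finite_subset[OF _ finite_lists_length_eq[of "V - {p}" r]]) (auto simp: star_words_def)

lemma star_words_fixes:
  assumes "xs \<in> star_words V p r f" "x \<notin> V" "x \<noteq> p"
  shows "f x = x"
proof -
  have "foldr (\<circ>) (map (\<lambda>i. transpose i p) xs) id x = x" if "x \<notin> set xs" for xs
    using that assms(3) by (induction xs) auto
  then show ?thesis using assms by (auto simp: star_words_def)
qed

text \<open>After the first letter i is removed, the rest either still contains i or has support
  \<open>V - {p}\<close> without i. These cases exclude each other, and the second one is counted
  over the carrier \<open>V - {i}\<close>.\<close>

lemma card_star_words_Suc:
  assumes V: "finite V"
  shows "card (star_words V p (Suc r) f) = (\<Sum>i\<in>V - {p}.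
    card (star_words V p r (transpose i p \<circ> f)) + card (star_words (V - {i}) p r (transpose i p \<circ> f)))"
proof -
  define W where "W i = star_words V p r (transpose i p \<circ> f) \<union> star_words (V - {i}) p r (transpose i p \<circ> f)" for i
  have "star_words V p (Suc r) f = (\<Union>i\<in>V - {p}. Cons i ` W i)"
  proof (intro equalityI subsetI)
    fix xs assume xs: "xs \<in> star_words V p (Suc r) f"
    then obtain i ys where [simp]: "xs = i # ys" by (cases xs) (auto simp: star_words_def)
    from xs have i: "i \<in> V - {p}" and s: "insert i (set ys) = V - {p}"
      and h: "transpose i p \<circ> foldr (\<circ>) (map (\<lambda>i. transpose i p) ys) id = f" and l: "length ys = r"
      by (auto simp: star_words_def)
    note h = iffD1[OF transpose_comp_eq_iff h]
    have "set ys = V - {p} \<or> set ys = V - {i} - {p}"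
    proof (cases "i \<in> set ys")
      case True
      then show ?thesis using s by (simp add: insert_absorb)
    next
      case False
      then have "set ys = insert i (set ys) - {i}" by simp
      then show ?thesis unfolding s by auto
    qed
    then have "ys \<in> W i" using h l by (auto simp: W_def star_words_def)
    then show "xs \<in> (\<Union>i\<in>V - {p}. Cons i ` W i)" using i by auto
  next
    fix xs assume "xs \<in> (\<Union>i\<in>V - {p}. Cons i ` W i)"
    then obtain i ys where i: "i \<in> V - {p}" "ys \<in> W i" and [simp]: "xs = i # ys" by auto
    then have "insert i (set ys) = V - {p}" "length ys = r"
      "foldr (\<circ>) (map (\<lambda>i. transpose i p) ys) id = transpose i p \<circ> f"
      by (auto simp: W_def star_words_def)
    moreover from this(3) have "transpose i p \<circ> foldr (\<circ>) (map (\<lambda>i. transpose i p) ys) id = f"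
      by (rule iffD2[OF transpose_comp_eq_iff])
    ultimately show "xs \<in> star_words V p (Suc r) f" by (simp add: star_words_def)
  qed
  moreover have "finite (W i)" for i using V by (simp add: W_def finite_star_words)
  ultimately have "card (star_words V p (Suc r) f) = (\<Sum>i\<in>V - {p}. card (Cons i ` W i))"
    using V by (simp only:) (subst card_UN_disjoint, auto)
  also have "\<dots> = (\<Sum>i\<in>V - {p}.
    card (star_words V p r (transpose i p \<circ> f)) + card (star_words (V - {i}) p r (transpose i p \<circ> f)))"
  proof (intro sum.cong refl)
    fix i assume i: "i \<in> V - {p}"
    have "star_words V p r (transpose i p \<circ> f) \<inter> star_words (V - {i}) p r (transpose i p \<circ> f) = {}"
      using i by (auto simp: star_words_def)
    then show "card (Cons i ` W i) =
        card (star_words V p r (transpose i p \<circ> f)) + card (star_words (V - {i}) p r (transpose i p \<circ> f))"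
      using V unfolding W_def by (subst card_image) (auto simp: card_Un_disjoint finite_star_words)
  qed
  finally show ?thesis .
qed

lemma star_series_singleton: "star_series {p} f = 1" if "f p = p"
proof -
  have "orbit f p = {p}" using that by (simp add: orbit_eq_singleton_iff)
  then have "fsinh 1 * reduced_series {p} f = fsinh 1 * 1"
    using reduced_series[of "{p}" f] by (simp add: cycle_series_def)
  then show ?thesis
    unfolding mult_left_cancel[OF fsinh_1_nth(3)] by (simp add: star_series_def)
qed

lemma star_series_nth_0: "2 \<le> card V \<Longrightarrow> star_series V f $ 0 = 0"
  using fsinh_1_nth(1) by (simp add: star_series_def fps_mult_nth startsby_zero_power)

text \<open>Induction on the length with V varying: coefficient r of the derivative of the star
  series is r + 1 times coefficient r + 1, which matches the recursion for words.\<close>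

lemma card_star_words:
  assumes "f permutes V" "finite V" "p \<in> V"
  shows "fact (card V) * real (card (star_words V p r f)) = fact r * star_series V f $ r"
  using assms
proof (induction r arbitrary: V f)
  case (0 V f)
  show ?case
  proof (cases "V = {p}")
    case True
    \<comment> \<open>On a single point the empty word is the only word, matching the constant star
      series 1.\<close>
    then have "f = id" using 0 by (simp add: permutes_sing)
    then have "star_words V p 0 f = {[]}" using True by (auto simp: star_words_def)
    moreover have "f p = p" using \<open>f = id\<close> by simp
    ultimately show ?thesis using True star_series_singleton[of f p] by simp
  next
    case False
    then have "V - {p} \<noteq> {}" using 0 by auto
    then have "star_words V p 0 f = {}" by (auto simp: star_words_def)
    moreover have "card V \<noteq> 0" "card V \<noteq> 1"
      using False 0 by (auto simp: card_1_singleton_iff)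
    then have "2 \<le> card V" by simp
    ultimately show ?thesis by (simp add: star_series_nth_0)
  qed
next
  case (Suc r V f)
  note f = Suc.prems(1,2) and p = Suc.prems(3)
  show ?case
  proof (cases "V = {p}")
    case True
    then have "f p = p" using f by (simp add: permutes_sing)
    moreover have "star_words V p (Suc r) f = {}" using True by (auto simp: star_words_def)
    ultimately show ?thesis using True by (simp add: star_series_singleton)
  next
    case False
    then have "card V \<noteq> 0" "card V \<noteq> 1"
      using f p by (auto simp: card_1_singleton_iff)
    then have V: "2 \<le> card V" by simp
    define g where "g i = transpose i p \<circ> f" for i
    define I where "I = {i \<in> V - {p}. f i = p}"
    have I: "finite I" "I \<subseteq> V - {p}" using f by (auto simp: I_def)
    have fin: "finite (V - {p})" using f by simp
    have gV: "g i permutes V" if "i \<in> V" for i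
      unfolding g_def using permutation_transpose_comp[OF f that p] by auto
    have gi: "g i i = i \<longleftrightarrow> f i = p" if "i \<in> V - {p}" for i
      using that by (auto simp: g_def transpose_eq_iff)
    have gVi: "g i permutes (V - {i})" if "i \<in> I" for i
    proof (rule permutes_superset)
      show "g i permutes V" using gV that I by auto
    qed (use gi[of i] that in \<open>auto simp: I_def\<close>)
    \<comment> \<open>A word over \<open>V - {i}\<close> with pivot p different from i fixes i, so
      only the points of I contribute to the shrinking case.\<close>
    have empty: "star_words (V - {i}) p r (g i) = {}" if "i \<in> V - {p} - I" for i
    proof (rule ccontr)
      assume "star_words (V - {i}) p r (g i) \<noteq> {}"
      then have "g i i = i" using star_words_fixes[of _ "V - {i}" p r "g i" i] that by auto
      then show False using gi[of i] that by (auto simp: I_def)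
    qed
    have 1: "fact (card V) * real (card (star_words V p r (g i))) = fact r * star_series V (g i) $ r"
      if "i \<in> V" for i
      using Suc.IH[OF gV[OF that] f(2) p] .
    \<comment> \<open>The induction hypothesis on the smaller carrier carries
      \<open>fact (card V - 1)\<close>; the missing factor of \<open>fact (card V)\<close> becomes
      the coefficient in \<open>deriv_star_series\<close>.\<close>
    have 2: "fact (card V) * real (card (star_words (V - {i}) p r (g i)))
        = of_nat (card V) * (fact r * star_series (V - {i}) (g i) $ r)" if "i \<in> I" for i
    proof -
      have "fact (card V) = of_nat (card V) * (fact (card (V - {i})) :: real)"
        using that I f V by (subst fact_reduce) auto
      moreover have "fact (card (V - {i})) * real (card (star_words (V - {i}) p r (g i)))
        = fact r * star_series (V - {i}) (g i) $ r"
        using Suc.IH[OF gVi[OF that]] f p that by (auto simp: I_def)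
      ultimately show ?thesis by simp
    qed
    have "(\<Sum>i\<in>V - {p}. fact (card V) * real (card (star_words (V - {i}) p r (g i))))
        = (\<Sum>i\<in>I. fact (card V) * real (card (star_words (V - {i}) p r (g i))))"
      using empty I fin by (intro sum.mono_neutral_right) auto
    also have "\<dots> = (\<Sum>i\<in>I. of_nat (card V) * (fact r * star_series (V - {i}) (g i) $ r))"
      using 2 by (intro sum.cong) auto
    finally have "fact (card V) * real (card (star_words V p (Suc r) f))
        = fact r * ((\<Sum>i\<in>V - {p}. star_series V (g i) $ r)
          + of_nat (card V) * (\<Sum>i\<in>I. star_series (V - {i}) (g i) $ r))"
      unfolding card_star_words_Suc[OF f(2)] g_def[symmetric]
      using 1 by (simp add: sum_distrib_left sum.distrib distrib_left mult.left_commute)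
    also have "(\<Sum>i\<in>V - {p}. star_series V (g i) $ r)
          + of_nat (card V) * (\<Sum>i\<in>I. star_series (V - {i}) (g i) $ r) = fps_deriv (star_series V f) $ r"
      unfolding deriv_star_series[OF f p V] g_def[symmetric] I_def[symmetric]
      by (simp add: fps_sum_nth fps_of_nat[symmetric])
    finally show ?thesis by simp
  qed
qed

section \<open>Factorizations into transpositions and a full cycle\<close>

lemma inj_on_transpose_less: "inj_on (\<lambda>(i, j). transpose i j) {(i, j). i < (j :: 'a :: linorder)}"
proof (rule inj_onI, clarify)
  fix a b c d :: 'a assume ab: "a < b" and cd: "c < d" and eq: "transpose a b = transpose c d"
  have "{x. transpose a b x \<noteq> x} = {a, b}" "{x. transpose c d x \<noteq> x} = {c, d}"
    using ab cd by (auto simp: transpose_eq_iff)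
  then have "{a, b} = {c, d}" using eq by simp
  then show "a = c \<and> b = d" using ab cd by (auto simp: doubleton_eq_iff)
qed

text \<open>Each transposition comes from exactly two ordered pairs; L and G collect the increasing
  and the decreasing ones.\<close>

lemma sum_transpositions:
  "2 * (\<Sum>\<tau>\<in>transpositions n. h \<tau>) = (\<Sum>p\<in>{1..n}. \<Sum>j\<in>{1..n} - {p}. h (transpose j p) :: 'a :: comm_semiring_1)"
proof -
  define L where "L = {(i, j). i \<in> {1..n} \<and> j \<in> {1..n} \<and> i < j}"
  define G where "G = {(i, j). i \<in> {1..n} \<and> j \<in> {1..n} \<and> j < i}"
  have fin: "finite L" "finite G"
    by (rule finite_subset[of _ "{1..n} \<times> {1..n}"]; auto simp: L_def G_def)+
  have "transpositions n = (\<lambda>(i, j). transpose i j) ` L"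
  proof (intro equalityI subsetI)
    fix \<tau> assume "\<tau> \<in> transpositions n"
    then obtain i j where "\<tau> = transpose i j" "i \<in> {1..n}" "j \<in> {1..n}" "i \<noteq> j"
      by (auto simp: transpositions_def)
    then have "\<tau> = transpose (min i j) (max i j)" "(min i j, max i j) \<in> L"
      by (auto simp: L_def min_def max_def transpose_commute)
    then show "\<tau> \<in> (\<lambda>(i, j). transpose i j) ` L" by force
  qed (auto simp: L_def transpositions_def)
  moreover have "inj_on (\<lambda>(i, j). transpose i j) L"
    by (rule inj_on_subset[OF inj_on_transpose_less]) (auto simp: L_def)
  ultimately have L: "(\<Sum>\<tau>\<in>transpositions n. h \<tau>) = (\<Sum>(i, j)\<in>L. h (transpose j i))"
    by (simp add: sum.reindex case_prod_unfold transpose_commute)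
  have "G = prod.swap ` L" by (auto simp: G_def L_def image_iff)
  then have G: "(\<Sum>(i, j)\<in>G. h (transpose j i)) = (\<Sum>(i, j)\<in>L. h (transpose j i))"
    by (simp add: sum.reindex case_prod_unfold transpose_commute)
  have "(\<Sum>p\<in>{1..n}. \<Sum>j\<in>{1..n} - {p}. h (transpose j p))
      = (\<Sum>(i, j)\<in>(SIGMA p:{1..n}. {1..n} - {p}). h (transpose j i))"
    by (subst sum.Sigma) auto
  also have "(SIGMA p:{1..n}. {1..n} - {p}) = L \<union> G" by (auto simp: L_def G_def)
  also have "(\<Sum>(i, j)\<in>L \<union> G. h (transpose j i))
      = (\<Sum>(i, j)\<in>L. h (transpose j i)) + (\<Sum>(i, j)\<in>G. h (transpose j i))"
    using fin by (intro sum.union_disjoint) (auto simp: L_def G_def)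
  finally show ?thesis using L G by (simp add: mult_2)
qed

lemma finite_transpositions: "finite (transpositions n)"
  by (rule finite_subset[of _ "(\<lambda>(i, j). transpose i j) ` ({1..n} \<times> {1..n})"])
    (auto simp: transpositions_def)

text \<open>Hence all series built from the cycle series are constant on a conjugacy class.\<close>

lemma cycle_series_cycle_type: "cycle_series {1..n} \<sigma> = (\<Prod>k\<in>#cycle_type n \<sigma>. fsinh (real k))"
  by (simp add: cycle_series_def cycle_type_def prod_unfold_prod_mset multiset.map_comp o_def)

lemma finite_cycle_factorizations: "finite (cycle_factorizations n s \<sigma>)"
proof (rule finite_subset)
  show "cycle_factorizations n s \<sigma> \<subseteq> {\<tau>s. set \<tau>s \<subseteq> transpositions n \<and> length \<tau>s = s} \<times> {c. c permutes {1..n}}"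
    by (auto simp: cycle_factorizations_def conj_class_def sym_group_carrier)
  show "finite ({\<tau>s. set \<tau>s \<subseteq> transpositions n \<and> length \<tau>s = s} \<times> {c. c permutes {1..n}})"
    by (simp add: finite_lists_length_eq finite_permutations finite_transpositions)
qed

text \<open>The first transposition is its own inverse, so it moves to the other side of the
  equation.\<close>

lemma card_cycle_factorizations_Suc:
  "card (cycle_factorizations n (Suc s) \<sigma>) = (\<Sum>\<tau>\<in>transpositions n. card (cycle_factorizations n s (\<tau> \<circ> \<sigma>)))"
proof -
  have pre_inj: "inj_on (\<lambda>(\<tau>s, c). (\<tau> # \<tau>s, c)) A" for \<tau> :: "nat \<Rightarrow> nat" and A :: "((nat \<Rightarrow> nat) list \<times> (nat \<Rightarrow> nat)) set"
    by (auto simp: inj_on_def)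
  have move: "\<tau> \<circ> h = \<sigma> \<longleftrightarrow> h = \<tau> \<circ> \<sigma>" if "\<tau> \<in> transpositions n" for \<tau> h
    using that by (auto simp: transpositions_def transpose_comp_eq_iff)
  have "cycle_factorizations n (Suc s) \<sigma>
      = (\<Union>\<tau>\<in>transpositions n. (\<lambda>(\<tau>s, c). (\<tau> # \<tau>s, c)) ` cycle_factorizations n s (\<tau> \<circ> \<sigma>))"
  proof (intro equalityI subsetI)
    fix x assume "x \<in> cycle_factorizations n (Suc s) \<sigma>"
    then obtain \<tau> \<tau>s c where "x = (\<tau> # \<tau>s, c)" "length \<tau>s = s" "\<tau> \<in> transpositions n"
        "set \<tau>s \<subseteq> transpositions n" "c \<in> conj_class {#n#}" "\<tau> \<circ> (perm_product \<tau>s \<circ> c) = \<sigma>"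
      by (auto simp: cycle_factorizations_def perm_product_def length_Suc_conv comp_assoc)
    then show "x \<in> (\<Union>\<tau>\<in>transpositions n. (\<lambda>(\<tau>s, c). (\<tau> # \<tau>s, c)) ` cycle_factorizations n s (\<tau> \<circ> \<sigma>))"
      using move by (force simp: cycle_factorizations_def)
  next
    fix x assume "x \<in> (\<Union>\<tau>\<in>transpositions n. (\<lambda>(\<tau>s, c). (\<tau> # \<tau>s, c)) ` cycle_factorizations n s (\<tau> \<circ> \<sigma>))"
    then obtain \<tau> \<tau>s c where x: "x = (\<tau> # \<tau>s, c)" "length \<tau>s = s" "\<tau> \<in> transpositions n"
        "set \<tau>s \<subseteq> transpositions n" "c \<in> conj_class {#n#}" "perm_product \<tau>s \<circ> c = \<tau> \<circ> \<sigma>"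
      by (auto simp: cycle_factorizations_def)
    then have "\<tau> \<circ> (perm_product \<tau>s \<circ> c) = \<sigma>" using move by simp
    then show "x \<in> cycle_factorizations n (Suc s) \<sigma>"
      using x by (auto simp: cycle_factorizations_def perm_product_def comp_assoc)
  qed
  then have "card (cycle_factorizations n (Suc s) \<sigma>)
      = (\<Sum>\<tau>\<in>transpositions n. card ((\<lambda>(\<tau>s, c). (\<tau> # \<tau>s, c)) ` cycle_factorizations n s (\<tau> \<circ> \<sigma>)))"
    by (simp only:) (subst card_UN_disjoint, auto simp: finite_cycle_factorizations finite_transpositions)
  then show ?thesis by (simp add: card_image[OF pre_inj])
qed

lemma cycle_type_eq_singleton_iff:
  assumes \<sigma>: "\<sigma> permutes {1..n}" and n: "1 \<le> n"
  shows "cycle_type n \<sigma> = {#n#} \<longleftrightarrow> card (orbit \<sigma> ` {1..n}) = 1"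
proof
  assume "cycle_type n \<sigma> = {#n#}"
  then have "size (cycle_type n \<sigma>) = 1" by simp
  then show "card (orbit \<sigma> ` {1..n}) = 1" by (simp add: cycle_type_def)
next
  assume "card (orbit \<sigma> ` {1..n}) = 1"
  then obtain D where D: "orbit \<sigma> ` {1..n} = {D}" by (auto simp: card_1_singleton_iff)
  have "permutation \<sigma>" using \<sigma> by (auto simp: permutation_permutes)
  then have "x \<in> D" if "x \<in> {1..n}" for x
    using permutation_self_in_orbit[of \<sigma> x] imageI[OF that, of "orbit \<sigma>"] unfolding D by simp
  then have "{1..n} \<subseteq> D" by blast
  moreover have "D \<subseteq> {1..n}"
  proof -
    have "orbit \<sigma> 1 \<in> orbit \<sigma> ` {1..n}" using n by (intro imageI) simp
    then have "orbit \<sigma> 1 = D" unfolding D by simp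
    then show ?thesis using permutes_orbit_subset[OF \<sigma>, of 1] n by simp
  qed
  ultimately have "D = {1..n}" by auto
  then show "cycle_type n \<sigma> = {#n#}" unfolding cycle_type_def D by simp
qed

text \<open>Induction on s: the sum of the reduced series over all transpositions is n times the
  derivative, and each step contributes the factors n and s + 1. For s = 0 the constant term must be
  n on full cycles and 0 elsewhere.\<close>

lemma card_cycle_factorizations:
  assumes "\<sigma> permutes {1..n}" "1 \<le> n"
  shows "real n * real (card (cycle_factorizations n s \<sigma>))
    = fact s * real n ^ s * reduced_series {1..n} \<sigma> $ s"
  using assms
proof (induction s arbitrary: \<sigma>)
  case (0 \<sigma>)
  have ne: "{1..n} \<noteq> {}" using 0 by simp
  have mem: "\<sigma> \<in> conj_class {#n#} \<longleftrightarrow> card (orbit \<sigma> ` {1..n}) = 1"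
    using 0 cycle_type_eq_singleton_iff[OF 0] by (simp add: conj_class_def sym_group_carrier)
  have cf: "cycle_factorizations n 0 \<sigma> = (if \<sigma> \<in> conj_class {#n#} then {([], \<sigma>)} else {})"
    by (auto simp: cycle_factorizations_def perm_product_def)
  show ?case
  proof (cases "card (orbit \<sigma> ` {1..n}) = 1")
    case True
    then have "cycle_type n \<sigma> = {#n#}" using cycle_type_eq_singleton_iff[OF 0] by simp
    then have "cycle_series {1..n} \<sigma> = fsinh (real n)"
      unfolding cycle_series_cycle_type by simp
    \<comment> \<open>Comparing coefficients of x gives the constant term n, since
      \<open>fsinh 1\<close> begins with x and \<open>fsinh n\<close> with n x.\<close>
    then have "fsinh (real n) $ 1 = (fsinh 1 * reduced_series {1..n} \<sigma>) $ 1"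
      using reduced_series[OF _ ne, of \<sigma>] by simp
    also have "\<dots> = reduced_series {1..n} \<sigma> $ 0"
      using fsinh_1_nth(1,2) by (simp add: fps_mult_nth)
    finally show ?thesis using cf mem True by (simp add: fsinh_def)
  next
    case False
    moreover have "0 < card (orbit \<sigma> ` {1..n})" using ne by (simp add: card_gt_0_iff)
    ultimately have "0 + 1 < card (orbit \<sigma> ` {1..n})" by linarith
    then have "reduced_series {1..n} \<sigma> $ 0 = 0"
      by (intro reduced_series_low_order) simp_all
    then show ?thesis using cf mem False by simp
  qed
next
  case (Suc s \<sigma>)
  have "real n * real (card (cycle_factorizations n (Suc s) \<sigma>))
      = (\<Sum>\<tau>\<in>transpositions n. real n * real (card (cycle_factorizations n s (\<tau> \<circ> \<sigma>))))"
    by (simp add: card_cycle_factorizations_Suc sum_distrib_left)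
  also have "\<dots> = (\<Sum>\<tau>\<in>transpositions n. fact s * real n ^ s * reduced_series {1..n} (\<tau> \<circ> \<sigma>) $ s)"
  proof (intro sum.cong refl)
    fix \<tau> assume "\<tau> \<in> transpositions n"
    then have "(\<tau> \<circ> \<sigma>) permutes {1..n}"
      using permutation_transpose_comp(1)[OF Suc.prems(1)] by (auto simp: transpositions_def)
    then show "real n * real (card (cycle_factorizations n s (\<tau> \<circ> \<sigma>)))
        = fact s * real n ^ s * reduced_series {1..n} (\<tau> \<circ> \<sigma>) $ s"
      using Suc by blast
  qed
  also have "\<dots> = fact s * real n ^ s * ((\<Sum>\<tau>\<in>transpositions n. reduced_series {1..n} (\<tau> \<circ> \<sigma>)) $ s)"
    by (simp add: sum_distrib_left fps_sum_nth)
  also have "(\<Sum>\<tau>\<in>transpositions n. reduced_series {1..n} (\<tau> \<circ> \<sigma>)) = of_nat n * fps_deriv (reduced_series {1..n} \<sigma>)"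
  proof -
    have "2 * (\<Sum>\<tau>\<in>transpositions n. reduced_series {1..n} (\<tau> \<circ> \<sigma>))
        = 2 * (of_nat n * fps_deriv (reduced_series {1..n} \<sigma>))"
      using sum_reduced_series_transpositions[OF Suc.prems(1)] by (simp add: sum_transpositions mult.assoc)
    then show ?thesis by simp
  qed
  finally show ?case by (simp add: fps_of_nat[symmetric] mult_ac)
qed

section \<open>The star and cycle numbers\<close>

text \<open>A point other than n that is missing from I is fixed by all generators and never reaches
  n. Conversely, any x goes to any y by way of the pivot. This turns transitivity into the support
  condition of \<open>star_words\<close>.\<close>

lemma generates_transitive_star_iff:
  assumes n: "1 \<le> n" and I: "I \<subseteq> {1..n} - {n}"
  shows "generates_transitive n ((\<lambda>i. transpose i n) ` I) \<longleftrightarrow> I = {1..n} - {n}"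
proof
  assume trans: "generates_transitive n ((\<lambda>i. transpose i n) ` I)"
  show "I = {1..n} - {n}"
  proof (rule ccontr)
    assume "I \<noteq> {1..n} - {n}"
    then obtain x where x: "x \<in> {1..n} - {n}" "x \<notin> I" using I by blast
    have "p x = x" if "p \<in> generate (sym_group n) ((\<lambda>i. transpose i n) ` I)" for p
      using that
    proof (induction rule: generate.induct)
      case one
      then show ?case by (simp add: sym_group_one)
    next
      case (incl h)
      then obtain i where i: "i \<in> I" "h = transpose i n" by auto
      then have "x \<noteq> i" using x by auto
      then show ?case using i x by simp
    next
      case (inv h)
      then obtain i where i: "i \<in> I" "h = transpose i n" by auto
      then have "x \<noteq> i" using x by auto
      \<comment> \<open>The group inverse is identified with the inverse function only for members
        of the carrier.\<close>
      then have perm: "h permutes {1..n}" unfolding i(2) using I n i(1) by (intro permutes_swap_id) auto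
      then have "m_inv (sym_group n) h = inv' h"
        by (rule sym_group_inv_equality[OF iffD2[OF sym_group_carrier]])
      then show ?case using i x \<open>x \<noteq> i\<close> by simp
    next
      case (eng h1 h2)
      then show ?case by (simp add: sym_group_mult)
    qed
    moreover obtain p where "p \<in> generate (sym_group n) ((\<lambda>i. transpose i n) ` I)" "p x = n"
      using trans x n unfolding generates_transitive_def by fastforce
    ultimately have "x = n" by metis
    then show False using x by simp
  qed
next
  assume I: "I = {1..n} - {n}"
  let ?T = "(\<lambda>i. transpose i n) ` I"
  \<comment> \<open>One element serves both directions, so composing two of them leads from x to n
    and on to y.\<close>
  have to_pivot: "\<exists>p\<in>generate (sym_group n) ?T. p x = n \<and> p n = x" if "x \<in> {1..n}" for x
  proof (cases "x = n")
    case True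
    then show ?thesis
      by (intro bexI[of _ id]) (use generate.one[of "sym_group n"] in \<open>auto simp: sym_group_one\<close>)
  next
    case False
    then have "transpose x n \<in> generate (sym_group n) ?T"
      using that I by (intro generate.incl) auto
    then show ?thesis by (intro bexI[of _ "transpose x n"]) auto
  qed
  show "generates_transitive n ?T"
    unfolding generates_transitive_def
  proof (intro ballI)
    fix x y assume "x \<in> {1..n}" "y \<in> {1..n}"
    then obtain p q where "p \<in> generate (sym_group n) ?T" "p x = n"
        and "q \<in> generate (sym_group n) ?T" "q n = y"
      using to_pivot by meson
    then show "\<exists>p\<in>generate (sym_group n) ?T. p x = y"
      by (intro bexI[of _ "q \<circ> p"]) (use generate.eng[of q "sym_group n" ?T p] in \<open>auto simp: sym_group_mult\<close>)
  qed
qed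

lemma card_star_factorizations:
  assumes n: "1 \<le> n"
  shows "card (star_factorizations n r \<sigma>) = card (star_words {1..n} n r \<sigma>)"
proof -
  let ?t = "\<lambda>i. transpose i n"
  have I: "{1..n - 1} = {1..n} - {n}" using n by auto
  have inj: "inj_on ?t A" for A
    by (rule inj_onI) (metis transpose_apply_second)
  have "star_factorizations n r \<sigma> = map ?t ` star_words {1..n} n r \<sigma>"
  proof (intro equalityI subsetI)
    fix ts assume ts: "ts \<in> star_factorizations n r \<sigma>"
    then have "ts \<in> lists (?t ` ({1..n} - {n}))"
      unfolding star_factorizations_def star_transpositions_def I[symmetric] by auto
    then obtain xs where xs: "xs \<in> lists ({1..n} - {n})" "ts = map ?t xs"
      unfolding lists_image by auto
    moreover have "generates_transitive n (?t ` set xs)"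
      using ts xs by (simp add: star_factorizations_def)
    then have "set xs = {1..n} - {n}"
      using generates_transitive_star_iff[OF n, of "set xs"] xs by auto
    ultimately show "ts \<in> map ?t ` star_words {1..n} n r \<sigma>"
      using ts by (intro image_eqI[of _ _ xs]) (simp_all add: star_factorizations_def star_words_def perm_product_def)
  next
    fix ts assume "ts \<in> map ?t ` star_words {1..n} n r \<sigma>"
    then obtain xs where xs: "ts = map ?t xs" "set xs = {1..n} - {n}" "length xs = r" "perm_product ts = \<sigma>"
      by (auto simp: star_words_def perm_product_def)
    moreover have "generates_transitive n (?t ` set xs)"
      using generates_transitive_star_iff[OF n, of "set xs"] xs by simp
    ultimately show "ts \<in> star_factorizations n r \<sigma>"
      unfolding star_factorizations_def star_transpositions_def I by auto
  qed
  then show ?thesis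
    using inj by (simp add: card_image inj_on_mapI)
qed

section \<open>Permutations of every cycle type\<close>

lemma cycle_type_add_fixpoint:
  assumes "\<sigma> permutes {1..n}"
  shows "cycle_type (Suc n) \<sigma> = add_mset 1 (cycle_type n \<sigma>)"
proof -
  have fx: "\<sigma> (Suc n) = Suc n" using assms by (rule permutes_not_in) simp
  then have "orbit \<sigma> (Suc n) = {Suc n}" by (simp add: orbit_eq_singleton_iff)
  moreover have "{1..Suc n} = insert (Suc n) {1..n}" by auto
  ultimately have "orbit \<sigma> ` {1..Suc n} = insert {Suc n} (orbit \<sigma> ` {1..n})"
    by (simp only: image_insert)
  moreover have "{Suc n} \<notin> orbit \<sigma> ` {1..n}"
    using permutes_orbit_subset[OF assms] by fastforce
  ultimately show ?thesis unfolding cycle_type_def by simp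
qed

text \<open>The new point \<open>Suc n\<close> is a fixed point of \<sigma>; joining it to a cycle
  of length a lengthens that cycle by one and leaves the others alone.\<close>

lemma cycle_type_join_fixpoint:
  assumes \<sigma>: "\<sigma> permutes {1..n}" and a: "cycle_type n \<sigma> = add_mset a \<alpha>"
  obtains \<tau> where "\<tau> permutes {1..Suc n}" "cycle_type (Suc n) \<tau> = add_mset (Suc a) \<alpha>"
proof -
  define Os where "Os = orbit \<sigma> ` {1..Suc n}"
  have \<sigma>': "\<sigma> permutes {1..Suc n}" by (rule permutes_subset[OF \<sigma>]) auto
  have fx: "\<sigma> (Suc n) = Suc n" using \<sigma> by (rule permutes_not_in) simp
  then have oN: "orbit \<sigma> (Suc n) = {Suc n}" by (simp add: orbit_eq_singleton_iff)
  have "a \<in># cycle_type n \<sigma>" using a by simp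
  then obtain p where p: "p \<in> {1..n}" "card (orbit \<sigma> p) = a" by (auto simp: cycle_type_def)
  have pV: "p \<in> {1..Suc n}" "Suc n \<in> {1..Suc n}" using p by auto
  have out: "Suc n \<notin> orbit \<sigma> p" using permutes_orbit_subset[OF \<sigma> p(1)] by auto
  define U where "U = orbit \<sigma> p \<union> {Suc n}"
  define \<tau> where "\<tau> = transpose (Suc n) p \<circ> \<sigma>"
  note jn = orbits_transpose_join[OF \<sigma>' _ pV out, folded \<tau>_def Os_def, unfolded oN, folded U_def]
  have \<tau>: "\<tau> permutes {1..Suc n}"
    unfolding \<tau>_def using permutation_transpose_comp(1)[OF \<sigma>' _ pV(2,1)] by simp
  define Rs where "Rs = Os - {orbit \<sigma> p, {Suc n}}"
  have fin: "finite Rs" by (simp add: Rs_def Os_def)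
  have "orbit \<sigma> p \<in> Os" "{Suc n} \<in> Os" using pV oN unfolding Os_def by force+
  then have "Os = insert (orbit \<sigma> p) (insert {Suc n} Rs)" by (auto simp: Rs_def)
  moreover have "orbit \<sigma> p \<noteq> {Suc n}" "orbit \<sigma> p \<notin> Rs" "{Suc n} \<notin> Rs" using out by (auto simp: Rs_def)
  ultimately have "cycle_type (Suc n) \<sigma> = {#a, 1#} + image_mset card (mset_set Rs)"
    unfolding cycle_type_def Os_def[symmetric] using fin p(2) by simp
  then have \<alpha>: "\<alpha> = image_mset card (mset_set Rs)"
    using cycle_type_add_fixpoint[OF \<sigma>] a by simp
  have "cycle_type (Suc n) \<tau> = add_mset (Suc a) \<alpha>"
    unfolding cycle_type_def \<alpha> using jn p(2) fin by (simp add: Rs_def)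
  then show ?thesis using that \<tau> by blast
qed

text \<open>Over an empty class every k would satisfy the condition defining
  \<open>star_number\<close> and \<open>cycle_number\<close>. A member is built part by part, each
  part starting as a new fixed point and growing by one point at a time.\<close>

lemma conj_class_nonempty:
  assumes "0 \<notin># \<alpha>"
  shows "conj_class \<alpha> \<noteq> {}"
proof -
  have "\<exists>\<sigma>. \<sigma> permutes {1..\<Sum>\<^sub># \<alpha>} \<and> cycle_type (\<Sum>\<^sub># \<alpha>) \<sigma> = \<alpha>"
    using assms
  proof (induction \<alpha>)
    case empty
    then show ?case by (intro exI[of _ id] conjI permutes_id) (simp add: cycle_type_def)
  next
    case (add a \<alpha>)
    then obtain \<sigma> where \<sigma>: "\<sigma> permutes {1..\<Sum>\<^sub># \<alpha>}" "cycle_type (\<Sum>\<^sub># \<alpha>) \<sigma> = \<alpha>" by auto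
    have "\<exists>\<sigma>. \<sigma> permutes {1..Suc k + \<Sum>\<^sub># \<alpha>} \<and> cycle_type (Suc k + \<Sum>\<^sub># \<alpha>) \<sigma> = add_mset (Suc k) \<alpha>" for k
    proof (induction k)
      case 0
      have "\<sigma> permutes {1..Suc (\<Sum>\<^sub># \<alpha>)}" by (rule permutes_subset[OF \<sigma>(1)]) auto
      then show ?case using cycle_type_add_fixpoint[OF \<sigma>(1)] \<sigma>(2) by auto
    next
      case (Suc k)
      then show ?case using cycle_type_join_fixpoint by (metis add_Suc)
    qed
    from this[of "a - 1"] show ?case using add.prems by (cases a) auto
  qed
  then show ?thesis by (auto simp: conj_class_def sym_group_carrier)
qed

section \<open>The two numbers as coefficients\<close>

lemma reduced_series_conj_class:
  assumes "\<sigma> \<in> conj_class \<alpha>" "\<sigma>' \<in> conj_class \<alpha>" "\<Sum>\<^sub># \<alpha> = n"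
  shows "reduced_series {1..n} \<sigma> = reduced_series {1..n} \<sigma>'"
  using assms unfolding reduced_series_def cycle_series_cycle_type conj_class_def by auto

text \<open>The count times \<open>fact n\<close> is the same coefficient for all members of the
  class. Cancelling \<open>fact n\<close> makes the count constant, and \<sigma> makes that value
  unique.\<close>

lemma fact_mult_star_number:
  fixes g :: nat
  assumes "partition_of \<alpha> n" "1 \<le> n" "\<sigma> \<in> conj_class \<alpha>"
  defines "r \<equiv> n + size \<alpha> - 2 + 2 * g"
  shows "fact n * real (star_number g \<alpha>) = fact r * star_series {1..n} \<sigma> $ r"
proof -
  have n: "\<Sum>\<^sub># \<alpha> = n" using assms by (simp add: partition_of_def)
  have eq: "fact n * real (card (star_factorizations n r \<tau>)) = fact r * star_series {1..n} \<sigma> $ r"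
    if "\<tau> \<in> conj_class \<alpha>" for \<tau>
  proof -
    have "\<tau> permutes {1..n}" using that n by (simp add: conj_class_def sym_group_carrier)
    then have "fact n * real (card (star_factorizations n r \<tau>)) = fact r * star_series {1..n} \<tau> $ r"
      using card_star_words[of \<tau> "{1..n}" n r] assms(2) by (simp add: card_star_factorizations)
    then show ?thesis
      using reduced_series_conj_class[OF that assms(3) n] by (simp add: star_series_def)
  qed
  have "card (star_factorizations n r \<tau>) = card (star_factorizations n r \<sigma>)" if "\<tau> \<in> conj_class \<alpha>" for \<tau>
  proof -
    have "fact n * real (card (star_factorizations n r \<tau>)) = fact n * real (card (star_factorizations n r \<sigma>))"
      using eq[OF that] eq[OF assms(3)] by simp
    then show ?thesis by simp
  qed
  then have "(THE k. \<forall>\<tau>\<in>conj_class \<alpha>. card (star_factorizations n r \<tau>) = k)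
      = card (star_factorizations n r \<sigma>)"
    using assms(3) by (intro the_equality) (blast, metis)
  then have "star_number g \<alpha> = card (star_factorizations n r \<sigma>)"
    unfolding star_number_def n r_def[symmetric] .
  then show ?thesis using eq[OF assms(3)] by simp
qed

lemma mult_cycle_number:
  fixes g :: nat
  assumes "partition_of \<alpha> n" "1 \<le> n" "\<sigma> \<in> conj_class \<alpha>"
  defines "s \<equiv> size \<alpha> - 1 + 2 * g"
  shows "real n * real (cycle_number g \<alpha>) = fact s * real n ^ s * reduced_series {1..n} \<sigma> $ s"
proof -
  have n: "\<Sum>\<^sub># \<alpha> = n" using assms by (simp add: partition_of_def)
  have eq: "real n * real (card (cycle_factorizations n s \<tau>))
      = fact s * real n ^ s * reduced_series {1..n} \<sigma> $ s" if "\<tau> \<in> conj_class \<alpha>" for \<tau>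
  proof -
    have "\<tau> permutes {1..n}" using that n by (simp add: conj_class_def sym_group_carrier)
    then show ?thesis
      using card_cycle_factorizations[of \<tau> n s] reduced_series_conj_class[OF that assms(3) n] assms(2) by simp
  qed
  have "card (cycle_factorizations n s \<tau>) = card (cycle_factorizations n s \<sigma>)" if "\<tau> \<in> conj_class \<alpha>" for \<tau>
  proof -
    have "real n * real (card (cycle_factorizations n s \<tau>)) = real n * real (card (cycle_factorizations n s \<sigma>))"
      using eq[OF that] eq[OF assms(3)] by simp
    then show ?thesis using assms(2) by simp
  qed
  then have "(THE k. \<forall>\<tau>\<in>conj_class \<alpha>. card (cycle_factorizations n s \<tau>) = k)
      = card (cycle_factorizations n s \<sigma>)"
    using assms(3) by (intro the_equality) (blast, metis)
  then have "cycle_number g \<alpha> = card (cycle_factorizations n s \<sigma>)"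
    unfolding cycle_number_def n s_def[symmetric] .
  then show ?thesis using eq[OF assms(3)] by simp
qed

text \<open>In the Cauchy product the index i of the power of \<open>fsinh 1\<close> must be at
  least n - 1 and of the same parity. Writing i = n - 1 + 2h, the order of the reduced series
  excludes h > g.\<close>

lemma star_series_nth:
  assumes \<sigma>: "\<sigma> \<in> conj_class \<alpha>" and n: "\<Sum>\<^sub># \<alpha> = n" "1 \<le> n" and m: "size \<alpha> = m"
  shows "star_series {1..n} \<sigma> $ (n + m - 2 + 2 * g)
    = (\<Sum>h=0..g. (fsinh 1 ^ (n - 1)) $ (n - 1 + 2 * h) * reduced_series {1..n} \<sigma> $ (m - 1 + 2 * (g - h)))"
proof -
  define r where "r = n + m - 2 + 2 * g"
  have m': "card (orbit \<sigma> ` {1..n}) = m"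
  proof -
    have "size (cycle_type n \<sigma>) = m" using \<sigma> n m by (auto simp: conj_class_def)
    then show ?thesis unfolding cycle_type_def by simp
  qed
  have "m \<ge> 1" using n m by (cases "\<alpha> = {#}") (auto simp: Suc_le_eq nonempty_has_size)
  have inj: "inj_on (\<lambda>h. n - 1 + 2 * h) {0..g}" by (auto simp: inj_on_def)
  have "star_series {1..n} \<sigma> $ r = (\<Sum>i=0..r. (fsinh 1 ^ (n - 1)) $ i * reduced_series {1..n} \<sigma> $ (r - i))"
    by (simp add: star_series_def fps_mult_nth)
  also have "\<dots> = (\<Sum>i\<in>(\<lambda>h. n - 1 + 2 * h) ` {0..g}. (fsinh 1 ^ (n - 1)) $ i * reduced_series {1..n} \<sigma> $ (r - i))"
  proof (intro sum.mono_neutral_right ballI)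
    show "(\<lambda>h. n - 1 + 2 * h) ` {0..g} \<subseteq> {0..r}" using n \<open>m \<ge> 1\<close> by (auto simp: r_def)
    fix i assume i: "i \<in> {0..r} - (\<lambda>h. n - 1 + 2 * h) ` {0..g}"
    consider "i < n - 1" | "odd (n - 1 + i)" | h where "i = n - 1 + 2 * h"
    proof (cases "i < n - 1 \<or> odd (n - 1 + i)")
      case False
      then have "even (i - (n - 1))" "n - 1 \<le> i" by auto
      then obtain h where "i - (n - 1) = 2 * h" by blast
      then have "i = n - 1 + 2 * h" using \<open>n - 1 \<le> i\<close> by simp
      then show ?thesis using that by blast
    qed (use that in blast)
    then show "(fsinh 1 ^ (n - 1)) $ i * reduced_series {1..n} \<sigma> $ (r - i) = 0"
    proof cases
      case 1
      then show ?thesis using startsby_zero_power_prefix[OF fsinh_1_nth(1)] by simp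
    next
      case 2
      then show ?thesis by (simp add: fsinh_1_power_parity)
    next
      case 3
      then have "g < h" using i by auto
      \<comment> \<open>As i is at most r, the index left for the reduced series is m - 1 - 2(h -
        g), below m - 1, where its coefficients vanish.\<close>
      then have "r - i + 1 < card (orbit \<sigma> ` {1..n})"
        using 3 i n \<open>m \<ge> 1\<close> unfolding m' by (auto simp: r_def)
      then show ?thesis by (simp add: reduced_series_low_order)
    qed
  qed simp
  also have "\<dots> = (\<Sum>h=0..g. (fsinh 1 ^ (n - 1)) $ (n - 1 + 2 * h) * reduced_series {1..n} \<sigma> $ (r - (n - 1 + 2 * h)))"
    by (subst sum.reindex[OF inj]) (simp only: o_def)
  also have "\<dots> = (\<Sum>h=0..g. (fsinh 1 ^ (n - 1)) $ (n - 1 + 2 * h) * reduced_series {1..n} \<sigma> $ (m - 1 + 2 * (g - h)))"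
  proof (intro sum.cong refl)
    fix h assume "h \<in> {0..g}"
    then have "r - (n - 1 + 2 * h) = m - 1 + 2 * (g - h)" using n \<open>m \<ge> 1\<close> by (auto simp: r_def)
    then show "(fsinh 1 ^ (n - 1)) $ (n - 1 + 2 * h) * reduced_series {1..n} \<sigma> $ (r - (n - 1 + 2 * h))
        = (fsinh 1 ^ (n - 1)) $ (n - 1 + 2 * h) * reduced_series {1..n} \<sigma> $ (m - 1 + 2 * (g - h))" by simp
  qed
  finally show ?thesis by (simp add: r_def)
qed

theorem corollary1p5:
  fixes g n m :: nat and \<alpha> :: "nat multiset"
  assumes "n \<ge> 1"
    and "partition_of \<alpha> n"
    and "size \<alpha> = m"
  shows "real (star_number g \<alpha>) =
    1 / fact n *
    (\<Sum>h=0..g.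
       real (cycle_number (g - h) \<alpha>) /
         real n powi (int m - 2 + 2 * int g - 2 * int h) *
       real ((n + m - 2 + 2 * g) choose (n - 1 + 2 * h)) *
       (\<Sum>j=0..n-1.
          real ((n - 1) choose j) * (- 1) ^ j *
          ((real n - 1) / 2 - real j) ^ (n - 1 + 2 * h)))"
proof -
  define r where "r = n + m - 2 + 2 * g"
  have n: "\<Sum>\<^sub># \<alpha> = n" and "0 \<notin># \<alpha>" using assms by (auto simp: partition_of_def)
  then obtain \<sigma> where \<sigma>: "\<sigma> \<in> conj_class \<alpha>" using conj_class_nonempty by blast
  have "m \<ge> 1" using n assms by (cases "\<alpha> = {#}") (auto simp: Suc_le_eq nonempty_has_size)
  have summand: "fact r * ((fsinh 1 ^ (n - 1)) $ (n - 1 + 2 * h) * reduced_series {1..n} \<sigma> $ (m - 1 + 2 * (g - h)))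
    = real (cycle_number (g - h) \<alpha>) / real n powi (int m - 2 + 2 * int g - 2 * int h) *
       real (r choose (n - 1 + 2 * h)) *
       (\<Sum>j=0..n-1. real ((n - 1) choose j) * (- 1) ^ j * ((real n - 1) / 2 - real j) ^ (n - 1 + 2 * h))"
    if h: "h \<in> {0..g}" for h
  proof -
    define k s where "k = n - 1 + 2 * h" and "s = m - 1 + 2 * (g - h)"
    have r: "r = k + s" using h \<open>n \<ge> 1\<close> \<open>m \<ge> 1\<close> by (auto simp: r_def k_def s_def)
    \<comment> \<open>The exponent is s - 1, which is -1 for m = 1 and h = g; hence the integer
      power. It is the power s from rescaling x by n, less one for the factor n in
      \<open>mult_cycle_number\<close>.\<close>
    have e: "int m - 2 + 2 * int g - 2 * int h = int s - 1"
      using h \<open>m \<ge> 1\<close> by (auto simp: s_def of_nat_diff)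
    have powi: "real n powi (int m - 2 + 2 * int g - 2 * int h) = real n ^ s / real n"
      unfolding e using assms(1) by (simp add: power_int_diff)
    have "real n * real (cycle_number (g - h) \<alpha>) = fact s * real n ^ s * reduced_series {1..n} \<sigma> $ s"
      using mult_cycle_number[OF assms(2,1) \<sigma>, of "g - h"] by (simp add: s_def assms(3))
    then have Q: "real (cycle_number (g - h) \<alpha>) / (real n ^ s / real n) = fact s * reduced_series {1..n} \<sigma> $ s"
      using assms(1) by (simp add: field_simps)
    have "(real n - 1) / 2 = real (n - 1) / 2" using assms(1) by (simp add: of_nat_diff)
    then have S: "(\<Sum>j=0..n-1. real ((n - 1) choose j) * (- 1) ^ j * ((real n - 1) / 2 - real j) ^ k)
        = fact k * (fsinh 1 ^ (n - 1)) $ k"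
      by (simp add: fsinh_1_power_nth atLeast0AtMost)
    \<comment> \<open>The binomial coefficient arises because coefficients of exponential generating
      functions are multiplied with r = k + s.\<close>
    have "fact r = real (r choose k) * fact k * fact s"
      using binomial_fact[of k r, where ?'a = real] r by (simp add: field_simps)
    then show ?thesis
      unfolding powi k_def[symmetric] s_def[symmetric] Q S by simp
  qed
  have "fact n * real (star_number g \<alpha>) = fact r * star_series {1..n} \<sigma> $ r"
    using fact_mult_star_number[OF assms(2,1) \<sigma>, of g] by (simp add: r_def assms(3))
  also have "\<dots> = (\<Sum>h=0..g. fact r * ((fsinh 1 ^ (n - 1)) $ (n - 1 + 2 * h)
      * reduced_series {1..n} \<sigma> $ (m - 1 + 2 * (g - h))))"
    unfolding r_def star_series_nth[OF \<sigma> n assms(1,3)] by (rule sum_distrib_left)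
  also note sum.cong[OF refl summand]
  finally show ?thesis by (simp add: r_def field_simps)
qed

end
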